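(* Let $M,m,A,A_1,B,B_1>0$ and $\mu:=\frac{2M+m}{m}$, and assume $\mu>1+\frac{A}{4A_1}$, $\mu>1+\frac{B}{16B_1}$ and $(\mu-1)^{4/15}\left(\frac{4A_1}{A}\right)^{2/3}\neq\left(\frac{16B_1}{B}\right)^{2/5}$. Consider the isosceles Schwarzschild problem with any angular momentum $C\in\mathbb R$. Then, on any energy level $\{H_{\mathrm{red}}=h\}$, $h\in\mathbb R$, the set of initial conditions leading to triple collision with a non-degenerate triangular limiting configuration has zero Lebesgue measure.
   Context: The isosceles Schwarzschild problem: two equal point masses $M$ move in a horizontal plane, symmetrically with respect to their midpoint $O$, and a third point mass $m$ moves on the vertical axis through $O$. Let $R>0$ be the distance between the equal masses and $z\in\mathbb R$ the signed height of $m$ above $O$. After reduction by rotations, with conserved angular momentum $C$, the motion is the Hamiltonian system on $\{(R,z,P_R,P_z):R>0\}$ with $$H_{\mathrm{red}}=\frac1M\left(P_R^2+\frac{C^2}{R^2}\right)+\frac{2M+m}{4Mm}P_z^2-\frac{A}{R}-\frac{B}{R^3}-\frac{4A_1}{(R^2+4z^2)^{1/2}}-\frac{16B_1}{(R^2+4z^2)^{3/2}}.$$ Lebesgue measure on the 3-dimensional energy level means the induced 3-dimensional measure. A solution leads to triple collision if $(R,z)\to(0,0)$ as $t$ tends to the forward end of its maximal interval of existence; its limiting geometric configuration is the limit $\ell=\lim z/R\in[-\infty,\infty]$ there. The limiting configuration is a non-degenerate triangle if $\ell$ is finite and nonzero. *)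

theory Defs
  imports "HOL-Analysis.Analysis"
begin

(* A point of phase space is (R, z, P_R, P_z).  The norm of the nested product type is the Euclidean
   norm of R^4. *)
type_synonym phase = "real \<times> real \<times> real \<times> real"

definition phase_space :: "phase set" where
  "phase_space = {(R, z, PR, Pz). R > 0}"

definition H_red ::
  "real \<Rightarrow> real \<Rightarrow> real \<Rightarrow> real \<Rightarrow> real \<Rightarrow> real \<Rightarrow> real \<Rightarrow> phase \<Rightarrow> real" where
  "H_red M m A A\<^sub>1 B B\<^sub>1 C = (\<lambda>(R, z, PR, Pz).
     1 / M * (PR\<^sup>2 + C\<^sup>2 / R\<^sup>2) + (2 * M + m) / (4 * M * m) * Pz\<^sup>2
     - A / R - B / R ^ 3
     - 4 * A\<^sub>1 / (R\<^sup>2 + 4 * z\<^sup>2) powr (1 / 2)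
     - 16 * B\<^sub>1 / (R\<^sup>2 + 4 * z\<^sup>2) powr (3 / 2))"

definition energy_level :: "(phase \<Rightarrow> real) \<Rightarrow> real \<Rightarrow> phase set" where
  "energy_level H h = {p \<in> phase_space. H p = h}"

definition hamiltonian_vector_field :: "(phase \<Rightarrow> real) \<Rightarrow> phase \<Rightarrow> phase" where
  "hamiltonian_vector_field H = (\<lambda>(R, z, PR, Pz).
     (deriv (\<lambda>p. H (R, z, p, Pz)) PR,
      deriv (\<lambda>p. H (R, z, PR, p)) Pz,
      - deriv (\<lambda>q. H (q, z, PR, Pz)) R,
      - deriv (\<lambda>q. H (R, q, PR, Pz)) z))"

definition is_solution ::
  "(phase \<Rightarrow> real) \<Rightarrow> ereal \<Rightarrow> ereal \<Rightarrow> (real \<Rightarrow> phase) \<Rightarrow> bool" where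
  "is_solution H a b x \<longleftrightarrow>
     (\<forall>t\<in>einterval a b. x t \<in> phase_space \<and>
        (x has_vector_derivative hamiltonian_vector_field H (x t)) (at t))"

definition is_maximal_solution ::
  "(phase \<Rightarrow> real) \<Rightarrow> ereal \<Rightarrow> ereal \<Rightarrow> (real \<Rightarrow> phase) \<Rightarrow> bool" where
  "is_maximal_solution H a b x \<longleftrightarrow>
     a < b \<and> is_solution H a b x \<and>
     (\<forall>a' b' y. a' \<le> a \<and> b \<le> b' \<and> is_solution H a' b' y \<and> (\<forall>t\<in>einterval a b. y t = x t)
        \<longrightarrow> a' = a \<and> b' = b)"

(* Limits at the forward end b, which may be infinite, follow the convention of interval integrals:
   composition with real_of_ereal and the filter at_left b on ereal. *)
definition leads_to_triple_collision :: "ereal \<Rightarrow> (real \<Rightarrow> phase) \<Rightarrow> bool" where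
  "leads_to_triple_collision b x \<longleftrightarrow>
     (((\<lambda>t. case x t of (R, z, PR, Pz) \<Rightarrow> (R, z)) \<circ> real_of_ereal) \<longlongrightarrow> (0, 0)) (at_left b)"

definition has_limiting_configuration :: "ereal \<Rightarrow> (real \<Rightarrow> phase) \<Rightarrow> ereal \<Rightarrow> bool" where
  "has_limiting_configuration b x l \<longleftrightarrow>
     (((\<lambda>t. case x t of (R, z, PR, Pz) \<Rightarrow> ereal (z / R)) \<circ> real_of_ereal) \<longlongrightarrow> l) (at_left b)"

definition nondegenerate_triangle :: "ereal \<Rightarrow> bool" where
  "nondegenerate_triangle l \<longleftrightarrow> \<bar>l\<bar> \<noteq> \<infinity> \<and> l \<noteq> 0"

definition triangular_collision_set :: "(phase \<Rightarrow> real) \<Rightarrow> real \<Rightarrow> phase set" where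
  "triangular_collision_set H h =
     {p \<in> energy_level H h. \<exists>a b x l.
        a < 0 \<and> 0 < b \<and> is_maximal_solution H a b x \<and> x 0 = p \<and>
        leads_to_triple_collision b x \<and>
        has_limiting_configuration b x l \<and> nondegenerate_triangle l}"

(* The d-dimensional Hausdorff outer measure, normalised by vol(unit ball of R^d) / 2^d so that on a
   d-dimensional C^1 submanifold it is the induced (Riemannian) d-dimensional Lebesgue measure.
   Being an outer measure it is defined on all sets; the sets on which it vanishes are the null sets
   of the completed measure.  A level set may contain critical points of the Hamiltonian, where it
   need not be a submanifold; Hausdorff measure covers these points as well. *)
definition hausdorff_premeasure :: "nat \<Rightarrow> real \<Rightarrow> 'a::metric_space set \<Rightarrow> ennreal" where
  "hausdorff_premeasure d \<delta> S =
     (INF U \<in> {U :: nat \<Rightarrow> 'a set. S \<subseteq> (\<Union>i. U i) \<and> (\<forall>i. bounded (U i) \<and> diameter (U i) \<le> \<delta>)}.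
        \<Sum>i. if U i = {} then 0 else ennreal (unit_ball_vol (real d) / 2 ^ d * diameter (U i) ^ d))"

definition hausdorff_outer_measure :: "nat \<Rightarrow> 'a::metric_space set \<Rightarrow> ennreal" where
  "hausdorff_outer_measure d S = (SUP \<delta>\<in>{0<..}. hausdorff_premeasure d \<delta> S)"

end

theory Submission
  imports Defs
begin

text \<open>
  Near a triple collision the variables can be rescaled by powers of \<open>R\<close>, the distance between the
  equal masses. Put \<open>q = z / R\<close> (the shape of the triangle) and \<open>w = q - (\<mu> / 4) (P\<^sub>z / P\<^sub>R)\<close>. On a
  fixed energy level \<open>P\<^sub>R\<close> is determined, up to sign, by \<open>(R, q, w)\<close>, and with the
  time variable \<open>s = - ln R\<close> the equations of motion become
  \<open>R' = - R\<close>, \<open>q' = w\<close>, \<open>w' = F (R, q, w)\<close>, where \<open>F\<close> is \<open>shape_field\<close> below. This \<open>F\<close>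
  is regular near \<open>R = 0\<close>, so that a triple collision is the limit \<open>s \<rightarrow> \<infinity>\<close>
  of an orbit of a regular system in three dimensions.

  The variable \<open>s\<close> is legitimate because the attraction proportional to \<open>1 / R\<^sup>4\<close> dominates the
  centrifugal force: close to collision \<open>P\<^sub>R\<close> is decreasing, hence eventually negative, hence \<open>R\<close> is
  decreasing (\<open>collision_momentum_negative\<close>). If \<open>q\<close> converges to \<open>l\<close>, l'Hopital's rule
  applied to \<open>P\<^sub>z / P\<^sub>R\<close> and to \<open>z / R\<close>, as functions of \<open>R\<close>, shows that the orbit converges to
  \<open>(0, l, 0)\<close> and that this point is an equilibrium (\<open>collision_limit\<close>). For \<open>l \<noteq> 0\<close> there are
  at most two equilibria, and \<open>\<partial>F / \<partial>q > 0\<close> at each of them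
  (\<open>equilibrium_is_saddle\<close>). Thus the linearisation has the eigenvalue \<open>- 1\<close>, from \<open>R' = - R\<close>,
  and one positive and one negative eigenvalue in the plane \<open>(q, w)\<close>: its stable subspace has only
  two dimensions, one fewer than the energy level.

  The set of orbits that tend to the saddle is bounded in size directly. Two orbits that remain close to the
  saddle for all \<open>s \<ge> 0\<close> have their difference in a cone around the stable subspace, since a
  difference outside the cone would grow exponentially (\<open>saddle_orbits_in_stable_cone\<close>). Hence
  two coordinates of the initial point control its distance from any other such point.
  Orbits that need a time \<open>T\<close> to come close to the saddle are compared at time \<open>T\<close>, and Gronwall's
  inequality carries the estimate back to time \<open>0\<close>. In this way the collision set is a countable
  union of pieces on which some map \<open>f\<close> to the plane satisfies
  \<open>dist x y \<le> K * dist (f x) (f y)\<close> (\<open>piece_null\<close>), and a set with such a map has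
  3-dimensional Hausdorff measure zero (\<open>hausdorff_null_of_expanding_map_to_plane\<close>).
\<close>

section \<open>Sets of Hausdorff measure zero\<close>

lemma hausdorff_outer_measure_eq_0I:
  fixes S :: "'a::metric_space set"
  assumes "\<And>\<delta> \<epsilon>. 0 < \<delta> \<Longrightarrow> 0 < \<epsilon> \<Longrightarrow>
    \<exists>U::nat \<Rightarrow> 'a set. S \<subseteq> (\<Union>i. U i) \<and> (\<forall>i. bounded (U i) \<and> diameter (U i) \<le> \<delta>) \<and>
      (\<Sum>i. if U i = {} then 0 else ennreal (unit_ball_vol (real d) / 2 ^ d * diameter (U i) ^ d))
        \<le> ennreal \<epsilon>"
  shows "hausdorff_outer_measure d S = 0"
proof -
  have "hausdorff_premeasure d \<delta> S \<le> 0" if "\<delta> > 0" for \<delta>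
  proof (rule ennreal_le_epsilon)
    fix e :: real assume "e > 0"
    then obtain U where U: "S \<subseteq> (\<Union>i. U i)" "\<forall>i. bounded (U i) \<and> diameter (U i) \<le> \<delta>"
      "(\<Sum>i. if U i = {} then 0 else ennreal (unit_ball_vol (real d) / 2 ^ d * diameter (U i) ^ d))
        \<le> ennreal e"
      using assms[OF \<open>\<delta> > 0\<close>] by blast
    show "hausdorff_premeasure d \<delta> S \<le> 0 + ennreal e"
      unfolding hausdorff_premeasure_def
      by (rule order.trans[OF INF_lower[where i = U]]) (use U in auto)
  qed
  then show ?thesis
    by (auto simp: hausdorff_outer_measure_def)
qed

lemma hausdorff_outer_measure_eq_0D:
  fixes S :: "'a::metric_space set"
  assumes "hausdorff_outer_measure d S = 0" "0 < \<delta>" "0 < \<epsilon>"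
  shows "\<exists>U::nat \<Rightarrow> 'a set. S \<subseteq> (\<Union>i. U i) \<and> (\<forall>i. bounded (U i) \<and> diameter (U i) \<le> \<delta>) \<and>
      (\<Sum>i. if U i = {} then 0 else ennreal (unit_ball_vol (real d) / 2 ^ d * diameter (U i) ^ d))
        \<le> ennreal \<epsilon>"
proof -
  have "hausdorff_premeasure d \<delta> S \<le> hausdorff_outer_measure d S"
    unfolding hausdorff_outer_measure_def by (rule SUP_upper) (use assms in auto)
  then have "hausdorff_premeasure d \<delta> S < ennreal \<epsilon>"
    using assms by (simp add: order.strict_iff_order)
  then show ?thesis
    unfolding hausdorff_premeasure_def INF_less_iff by (auto intro: less_imp_le)
qed

text \<open>
  The usual argument with \<open>\<epsilon> / 2 ^ n\<close>; it is carried out by hand because the definition is an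
  infimum over sequences of sets and does not come with a measure space.
\<close>
lemma hausdorff_null_UN_nat:
  fixes S :: "nat \<Rightarrow> 'a::metric_space set"
  assumes "\<And>n. hausdorff_outer_measure d (S n) = 0"
  shows "hausdorff_outer_measure d (\<Union>n. S n) = 0"
proof (rule hausdorff_outer_measure_eq_0I)
  fix \<delta> \<epsilon> :: real assume pos: "0 < \<delta>" "0 < \<epsilon>"
  let ?w = "\<lambda>V::'a set. if V = {} then 0
    else ennreal (unit_ball_vol (real d) / 2 ^ d * diameter V ^ d)"
  have "\<exists>U. S n \<subseteq> (\<Union>i. U i) \<and> (\<forall>i. bounded (U i) \<and> diameter (U i) \<le> \<delta>) \<and>
      (\<Sum>i. ?w (U i)) \<le> ennreal (\<epsilon> * (1/2) ^ Suc n)" for n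
    by (rule hausdorff_outer_measure_eq_0D[OF assms]) (use pos in auto)
  then have "\<exists>U. \<forall>n. S n \<subseteq> (\<Union>i. U n i) \<and> (\<forall>i. bounded (U n i) \<and> diameter (U n i) \<le> \<delta>) \<and>
      (\<Sum>i. ?w (U n i)) \<le> ennreal (\<epsilon> * (1/2) ^ Suc n)"
    by (intro choice allI)
  then obtain U where U: "\<And>n. S n \<subseteq> (\<Union>i. U n i)"
    "\<And>n i. bounded (U n i) \<and> diameter (U n i) \<le> \<delta>"
    "\<And>n. (\<Sum>i. ?w (U n i)) \<le> ennreal (\<epsilon> * (1/2) ^ Suc n)"
    by blast
  define W where "W k = (case prod_decode k of (n, i) \<Rightarrow> U n i)" for k
  have "(\<Sum>k. ?w (W k)) = (\<Sum>k. (\<lambda>(n, i). ?w (U n i)) (prod_decode k))"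
    by (simp only: W_def case_prod_beta)
  also have "\<dots> = (\<Sum>n. \<Sum>i. ?w (U n i))"
    by (rule suminf_ennreal_2dimen) simp
  also have "\<dots> \<le> (\<Sum>n. ennreal (\<epsilon> * (1/2) ^ Suc n))"
    by (intro suminf_le U(3)) auto
  also have "\<dots> = ennreal \<epsilon>"
  proof (rule suminf_ennreal_eq)
    show "(\<lambda>n. \<epsilon> * (1/2) ^ Suc n) sums \<epsilon>"
      using sums_mult[OF power_half_series, of \<epsilon>] by simp
  qed (use pos in auto)
  finally have sum: "(\<Sum>k. ?w (W k)) \<le> ennreal \<epsilon>" .
  have "x \<in> (\<Union>k. W k)" if "x \<in> S n" for x n
  proof -
    from U(1)[of n] that obtain i where "x \<in> U n i" by auto
    then have "x \<in> W (prod_encode (n, i))" by (simp add: W_def)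
    then show ?thesis by blast
  qed
  then show "\<exists>U. (\<Union>n. S n) \<subseteq> (\<Union>i. U i) \<and> (\<forall>i. bounded (U i) \<and> diameter (U i) \<le> \<delta>) \<and>
      (\<Sum>i. ?w (U i)) \<le> ennreal \<epsilon>"
    using sum U(2) by (intro exI[of _ W]) (auto simp: W_def split: prod.splits)
qed

lemma hausdorff_null_subset:
  assumes "hausdorff_outer_measure d T = 0" "S \<subseteq> T"
  shows "hausdorff_outer_measure d S = 0"
proof (rule hausdorff_outer_measure_eq_0I, goal_cases)
  case (1 \<delta> \<epsilon>)
  from hausdorff_outer_measure_eq_0D[OF assms(1) 1] assms(2) show ?case by (meson order_trans)
qed

lemma hausdorff_null_UN_countable:
  fixes S :: "'i \<Rightarrow> 'a::metric_space set"
  assumes "countable I" "\<And>i. i \<in> I \<Longrightarrow> hausdorff_outer_measure d (S i) = 0"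
  shows "hausdorff_outer_measure d (\<Union>i\<in>I. S i) = 0"
proof (cases "I = {}")
  case True
  show ?thesis unfolding True
    by (rule hausdorff_outer_measure_eq_0I) (auto intro: exI[of _ "\<lambda>_. {}"])
next
  case False
  have "hausdorff_outer_measure d (\<Union>n. S (from_nat_into I n)) = 0"
    by (intro hausdorff_null_UN_nat assms(2) from_nat_into False)
  moreover have "(\<Union>i\<in>I. S i) = (\<Union>n. S (from_nat_into I n))"
    using range_from_nat_into[OF False assms(1)] by (metis image_image)
  ultimately show ?thesis by simp
qed

text \<open>
  Cutting the square into cells of side \<open>1 / N\<close> pulls \<open>S\<close> back to \<open>(2 m N)\<^sup>2\<close> sets
  of diameter \<open>O (1 / N)\<close>. Their contributions of order \<open>1 / N ^ d\<close> add up to \<open>O (N ^ (2 - d))\<close>,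
  which tends to \<open>0\<close> for \<open>d > 2\<close>.
\<close>
lemma hausdorff_null_of_bounded_expanding_map_to_plane:
  fixes f :: "'a::metric_space \<Rightarrow> real \<times> real"
  assumes d: "2 < d"
    and f: "\<And>x y. x \<in> S \<Longrightarrow> y \<in> S \<Longrightarrow> dist x y \<le> K * dist (f x) (f y)"
    and m: "\<And>x. x \<in> S \<Longrightarrow> f x \<in> {- real m..<real m} \<times> {- real m..<real m}"
  shows "hausdorff_outer_measure d S = 0"
proof (rule hausdorff_outer_measure_eq_0I)
  fix \<delta> \<epsilon> :: real assume pos: "0 < \<delta>" "0 < \<epsilon>"
  define L where "L = 2 * \<bar>K\<bar>"
  define c where "c = unit_ball_vol (real d) / 2 ^ d"
  have L: "L \<ge> 0" and c: "c \<ge> 0" by (auto simp: L_def c_def)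
  obtain N :: nat where N: "N > 0" "L / N \<le> \<delta>" "(2 * real m)\<^sup>2 * c * L ^ d / N \<le> \<epsilon>"
  proof -
    obtain N :: nat where "real N > max 1 (max (L / \<delta>) ((2 * real m)\<^sup>2 * c * L ^ d / \<epsilon>))"
      using reals_Archimedean2 by blast
    then show ?thesis
      using pos by (intro that[of N]) (auto simp: field_simps)
  qed
  define cell where "cell = (\<lambda>(a::int, b::int).
    {x \<in> S. \<lfloor>N * fst (f x)\<rfloor> = a \<and> \<lfloor>N * snd (f x)\<rfloor> = b})"
  have close: "dist x y \<le> L / N" if "x \<in> cell ab" "y \<in> cell ab" for x y ab
  proof -
    have *: "\<bar>u - v\<bar> \<le> 1 / N" if "\<lfloor>N * u\<rfloor> = \<lfloor>N * v\<rfloor>" for u v :: real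
    proof -
      have "\<bar>N * u - N * v\<bar> \<le> 1"
        using that by linarith
      then have "N * \<bar>u - v\<bar> \<le> 1"
        by (simp add: abs_mult flip: right_diff_distrib)
      then show ?thesis
        using N(1) by (simp add: field_simps)
    qed
    have xy: "x \<in> S" "y \<in> S" "\<lfloor>N * fst (f x)\<rfloor> = \<lfloor>N * fst (f y)\<rfloor>" "\<lfloor>N * snd (f x)\<rfloor> = \<lfloor>N * snd (f y)\<rfloor>"
      using that by (auto simp: cell_def split: prod.splits)
    have "dist (f x) (f y) \<le> dist (fst (f x)) (fst (f y)) + dist (snd (f x)) (snd (f y))"
      unfolding dist_prod_def by (rule sqrt_sum_squares_le_sum) auto
    also have "\<dots> \<le> 1 / N + 1 / N"
      using *[OF xy(3)] *[OF xy(4)] by (simp add: dist_real_def)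
    finally have "\<bar>K\<bar> * dist (f x) (f y) \<le> \<bar>K\<bar> * (2 / N)"
      by (intro mult_left_mono) auto
    moreover have "dist x y \<le> \<bar>K\<bar> * dist (f x) (f y)"
      using f[OF xy(1,2)] by (smt (verit) mult_right_mono zero_le_dist)
    ultimately show ?thesis by (simp add: L_def mult.commute)
  qed
  define F where "F = {- int (m * N)..<int (m * N)} \<times> {- int (m * N)..<int (m * N)}"
  have F: "finite F" "card F = (2 * m * N)\<^sup>2"
  proof -
    have "int (m * N) - - int (m * N) = int (2 * m * N)" by simp
    then have "nat (int (m * N) - - int (m * N)) = 2 * m * N" by (simp only: nat_int)
    then show "card F = (2 * m * N)\<^sup>2"
      unfolding F_def card_cartesian_product power2_eq_square by (simp only: card_atLeastLessThan_int)
  qed (simp add: F_def)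
  obtain e where e: "bij_betw e {0..<card F} F"
    using ex_bij_betw_nat_finite[OF F(1)] by blast
  define U where "U k = (if k < card F then cell (e k) else {})" for k
  have cover: "S \<subseteq> (\<Union>k. U k)"
  proof
    fix x assume x: "x \<in> S"
    have *: "\<lfloor>N * u\<rfloor> \<in> {- int (m * N)..<int (m * N)}" if "u \<in> {- real m..<real m}" for u :: real
    proof -
      have "- real (m * N) \<le> N * u"
        using mult_left_mono[of "- real m" u "real N"] that by (simp add: mult.commute)
      moreover have "N * u < m * N" using that N(1) by (simp add: mult.commute)
      ultimately show ?thesis by (auto simp: le_floor_iff floor_less_iff)
    qed
    have "(\<lfloor>N * fst (f x)\<rfloor>, \<lfloor>N * snd (f x)\<rfloor>) \<in> F"
      unfolding F_def using m[OF x] * by (auto simp: mem_Times_iff)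
    then obtain k where "k < card F" "e k = (\<lfloor>N * fst (f x)\<rfloor>, \<lfloor>N * snd (f x)\<rfloor>)"
      using e unfolding bij_betw_def by (metis atLeast0LessThan imageE lessThan_iff)
    then have "x \<in> U k" using x by (simp add: U_def cell_def)
    then show "x \<in> (\<Union>k. U k)" by blast
  qed
  have bd: "bounded (U k)" and diam: "diameter (U k) \<le> L / N" for k
  proof -
    have close': "dist x y \<le> L / N" if "x \<in> U k" "y \<in> U k" for x y
      using that close by (auto simp: U_def split: if_splits)
    then show "bounded (U k)"
      unfolding bounded_two_points by blast
    show "diameter (U k) \<le> L / N"
      using close' L by (auto simp: diameter_def intro!: cSUP_least)
  qed
  have "(\<Sum>k. if U k = {} then 0 else ennreal (c * diameter (U k) ^ d)) =
      (\<Sum>k<card F. if U k = {} then 0 else ennreal (c * diameter (U k) ^ d))"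
    by (rule suminf_finite) (auto simp: U_def)
  also have "\<dots> \<le> (\<Sum>k<card F. ennreal (c * (L / N) ^ d))"
    by (intro sum_mono) (auto intro!: ennreal_leI mult_left_mono power_mono diam c diameter_ge_0 bd)
  also have "\<dots> = ennreal (card F * (c * (L / N) ^ d))"
    by (simp add: ennreal_of_nat_eq_real_of_nat ennreal_mult' )
  also have "\<dots> \<le> ennreal \<epsilon>"
  proof (rule ennreal_leI)
    have "real N ^ 3 \<le> real N ^ d"
      using N(1) d by (intro power_increasing) auto
    then have "(L / N) ^ d \<le> L ^ d / N ^ 3"
      using L N(1) by (simp add: power_divide divide_left_mono)
    then have "card F * (c * (L / N) ^ d) \<le> card F * (c * (L ^ d / N ^ 3))"
      using c by (intro mult_left_mono) auto
    also have "\<dots> = (2 * real m)\<^sup>2 * c * L ^ d / N"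
      using N(1) by (simp add: F(2) field_simps power2_eq_square power3_eq_cube)
    finally show "card F * (c * (L / N) ^ d) \<le> \<epsilon>" using N(3) by simp
  qed
  finally have "(\<Sum>k. if U k = {} then 0 else ennreal (c * diameter (U k) ^ d)) \<le> ennreal \<epsilon>" .
  then show "\<exists>U. S \<subseteq> (\<Union>i. U i) \<and> (\<forall>i. bounded (U i) \<and> diameter (U i) \<le> \<delta>) \<and>
      (\<Sum>i. if U i = {} then 0 else ennreal (unit_ball_vol (real d) / 2 ^ d * diameter (U i) ^ d))
        \<le> ennreal \<epsilon>"
    using cover bd diam N(2) unfolding c_def by (intro exI[of _ U]) (auto intro: order_trans)
qed

lemma hausdorff_null_of_expanding_map_to_plane:
  fixes f :: "'a::metric_space \<Rightarrow> real \<times> real"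
  assumes d: "2 < d"
    and f: "\<And>x y. x \<in> S \<Longrightarrow> y \<in> S \<Longrightarrow> dist x y \<le> K * dist (f x) (f y)"
  shows "hausdorff_outer_measure d S = 0"
proof -
  define S' where "S' m = {x \<in> S. f x \<in> {- real m..<real m} \<times> {- real m..<real m}}" for m
  have "x \<in> (\<Union>m. S' m)" if "x \<in> S" for x
  proof -
    obtain m :: nat where "real m > max \<bar>fst (f x)\<bar> \<bar>snd (f x)\<bar>"
      using reals_Archimedean2 by blast
    then have "x \<in> S' m" using that by (auto simp: S'_def mem_Times_iff)
    then show ?thesis by blast
  qed
  moreover have "hausdorff_outer_measure d (\<Union>m. S' m) = 0"
    by (intro hausdorff_null_UN_nat hausdorff_null_of_bounded_expanding_map_to_plane[OF d f])
      (auto simp: S'_def)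
  ultimately show ?thesis
    using hausdorff_null_subset[of d "\<Union>m. S' m" S] by blast
qed

section \<open>Strict differentiability\<close>

text \<open>
  The condition compares two variable points, whereas the Frechet derivative compares one variable point
  with \<open>a\<close>. This is the right strength for differences of two orbits near an equilibrium, and,
  unlike continuous differentiability, it needs no derivatives at the other points.
\<close>
definition has_strict_derivative ::
  "('a::real_normed_vector \<Rightarrow> 'b::real_normed_vector) \<Rightarrow> ('a \<Rightarrow> 'b) \<Rightarrow> 'a \<Rightarrow> bool" where
  "has_strict_derivative f f' a \<longleftrightarrow> bounded_linear f' \<and>
     (\<forall>\<epsilon>>0. \<exists>\<delta>>0. \<forall>x\<in>ball a \<delta>. \<forall>y\<in>ball a \<delta>. norm (f x - f y - f' (x - y)) \<le> \<epsilon> * norm (x - y))"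

definition strictly_differentiable ::
  "('a::real_normed_vector \<Rightarrow> 'b::real_normed_vector) \<Rightarrow> 'a \<Rightarrow> bool" where
  "strictly_differentiable f a \<longleftrightarrow> (\<exists>f'. has_strict_derivative f f' a)"

lemma has_strict_derivativeD:
  assumes "has_strict_derivative f f' a" "\<epsilon> > 0"
  obtains \<delta> where "\<delta> > 0"
    "\<And>x y. x \<in> ball a \<delta> \<Longrightarrow> y \<in> ball a \<delta> \<Longrightarrow> norm (f x - f y - f' (x - y)) \<le> \<epsilon> * norm (x - y)"
  using assms unfolding has_strict_derivative_def by meson

lemma has_strict_derivative_imp_has_derivative:
  assumes "has_strict_derivative f f' a"
  shows "(f has_derivative f') (at a)"
  unfolding has_derivative_at_alt
proof (intro conjI allI impI)
  show "bounded_linear f'" using assms by (simp add: has_strict_derivative_def)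
  fix e :: real assume "e > 0"
  from has_strict_derivativeD[OF assms this] obtain \<delta> where \<delta>: "\<delta> > 0"
    "\<And>x y. x \<in> ball a \<delta> \<Longrightarrow> y \<in> ball a \<delta> \<Longrightarrow> norm (f x - f y - f' (x - y)) \<le> e * norm (x - y)"
    by blast
  show "\<exists>d>0. \<forall>y. norm (y - a) < d \<longrightarrow> norm (f y - f a - f' (y - a)) \<le> e * norm (y - a)"
  proof (intro exI[of _ \<delta>] conjI allI impI)
    fix y assume "norm (y - a) < \<delta>"
    then show "norm (f y - f a - f' (y - a)) \<le> e * norm (y - a)"
      using \<delta> by (intro \<delta>(2)) (auto simp: dist_norm norm_minus_commute)
  qed (use \<delta> in auto)
qed

lemma has_strict_derivative_imp_lipschitz:
  assumes "has_strict_derivative f f' a"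
  obtains \<delta> L where "\<delta> > 0" "L \<ge> 0"
    "\<And>x y. x \<in> ball a \<delta> \<Longrightarrow> y \<in> ball a \<delta> \<Longrightarrow> norm (f x - f y) \<le> L * norm (x - y)"
proof -
  obtain \<delta> where \<delta>: "\<delta> > 0"
    "\<And>x y. x \<in> ball a \<delta> \<Longrightarrow> y \<in> ball a \<delta> \<Longrightarrow> norm (f x - f y - f' (x - y)) \<le> 1 * norm (x - y)"
    using has_strict_derivativeD[OF assms, of 1] by auto
  obtain K where K: "K \<ge> 0" "\<And>v. norm (f' v) \<le> K * norm v"
    using bounded_linear.nonneg_bounded[of f'] assms
    by (auto simp: has_strict_derivative_def mult.commute)
  have "norm (f x - f y) \<le> (1 + K) * norm (x - y)" if "x \<in> ball a \<delta>" "y \<in> ball a \<delta>" for x y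
    using \<delta>(2)[OF that] K(2)[of "x - y"] norm_triangle_sub[of "f x - f y" "f' (x - y)"]
    by (simp add: distrib_right)
  then show ?thesis using that[of \<delta> "1 + K"] \<delta>(1) K(1) by simp
qed

lemma strictly_differentiable_bounded_linear:
  assumes "bounded_linear f"
  shows "strictly_differentiable f a"
proof -
  have "f x - f y - f (x - y) = 0" for x y
    using bounded_linear.linear[OF assms] by (simp add: linear_diff)
  then have "has_strict_derivative f f a"
    using assms unfolding has_strict_derivative_def by (auto intro!: exI[of _ 1])
  then show ?thesis unfolding strictly_differentiable_def by blast
qed

lemma strictly_differentiable_const: "strictly_differentiable (\<lambda>_. c) a"
proof -
  have "has_strict_derivative (\<lambda>_. c) (\<lambda>_. 0) a"
    unfolding has_strict_derivative_def by (auto intro!: exI[of _ 1])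
  then show ?thesis unfolding strictly_differentiable_def by blast
qed

lemma strictly_differentiable_compose:
  fixes f :: "'a::real_normed_vector \<Rightarrow> 'b::real_normed_vector"
    and g :: "'b \<Rightarrow> 'c::real_normed_vector"
  assumes "strictly_differentiable g (f a)" "strictly_differentiable f a"
  shows "strictly_differentiable (\<lambda>x. g (f x)) a"
proof -
  obtain f' g' where f': "has_strict_derivative f f' a" and g': "has_strict_derivative g g' (f a)"
    using assms unfolding strictly_differentiable_def by blast
  obtain \<delta>1 L where L: "\<delta>1 > 0" "L \<ge> 0"
    "\<And>x y. x \<in> ball a \<delta>1 \<Longrightarrow> y \<in> ball a \<delta>1 \<Longrightarrow> norm (f x - f y) \<le> L * norm (x - y)"
    using has_strict_derivative_imp_lipschitz[OF f'] by blast
  have lin: "bounded_linear g'" "bounded_linear f'"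
    using f' g' by (auto simp: has_strict_derivative_def)
  obtain K where K: "K \<ge> 0" "\<And>v. norm (g' v) \<le> K * norm v"
    using bounded_linear.nonneg_bounded[OF lin(1)] by (auto simp: mult.commute)
  have "has_strict_derivative (\<lambda>x. g (f x)) (\<lambda>v. g' (f' v)) a"
    unfolding has_strict_derivative_def
  proof (intro conjI allI impI)
    show "bounded_linear (\<lambda>v. g' (f' v))" using bounded_linear_compose[OF lin] .
    fix e :: real assume e: "e > 0"
    define \<epsilon>1 where "\<epsilon>1 = e / 2 / (L + 1)"
    define \<epsilon>2 where "\<epsilon>2 = e / 2 / (K + 1)"
    have \<epsilon>: "\<epsilon>1 > 0" "\<epsilon>2 > 0" "\<epsilon>1 * L \<le> e / 2" "K * \<epsilon>2 \<le> e / 2"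
      using e L(2) K(1) by (auto simp: \<epsilon>1_def \<epsilon>2_def field_simps)
    obtain \<eta> where \<eta>: "\<eta> > 0" "\<And>x y. x \<in> ball (f a) \<eta> \<Longrightarrow> y \<in> ball (f a) \<eta> \<Longrightarrow>
        norm (g x - g y - g' (x - y)) \<le> \<epsilon>1 * norm (x - y)"
      using has_strict_derivativeD[OF g' \<epsilon>(1)] by blast
    obtain \<delta>2 where \<delta>2: "\<delta>2 > 0" "\<And>x y. x \<in> ball a \<delta>2 \<Longrightarrow> y \<in> ball a \<delta>2 \<Longrightarrow>
        norm (f x - f y - f' (x - y)) \<le> \<epsilon>2 * norm (x - y)"
      using has_strict_derivativeD[OF f' \<epsilon>(2)] by blast
    define \<delta> where "\<delta> = min (min \<delta>1 \<delta>2) (\<eta> / (L + 1))"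
    have "\<delta> > 0" using \<open>\<delta>1 > 0\<close> \<open>\<delta>2 > 0\<close> \<eta>(1) L(2) by (auto simp: \<delta>_def)
    moreover have "norm (g (f x) - g (f y) - g' (f' (x - y))) \<le> e * norm (x - y)"
      if xy: "x \<in> ball a \<delta>" "y \<in> ball a \<delta>" for x y
    proof -
      have in_ball: "f x \<in> ball (f a) \<eta>" if "x \<in> ball a \<delta>" for x
      proof -
        have "norm (f x - f a) \<le> L * norm (x - a)"
          using that \<open>\<delta>1 > 0\<close> by (intro L(3)) (auto simp: \<delta>_def)
        also have "\<dots> \<le> (L + 1) * norm (x - a)" by (intro mult_right_mono) auto
        also have "\<dots> < \<eta>"
        proof -
          have "norm (x - a) < \<eta> / (L + 1)"
            using that by (auto simp: \<delta>_def dist_norm norm_minus_commute)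
          then show ?thesis using L(2) by (simp add: field_simps)
        qed
        finally show ?thesis by (simp add: dist_norm norm_minus_commute)
      qed
      have "norm (g (f x) - g (f y) - g' (f x - f y)) \<le> \<epsilon>1 * norm (f x - f y)"
        by (intro \<eta>(2) in_ball xy)
      also have "\<dots> \<le> \<epsilon>1 * (L * norm (x - y))"
        using xy \<epsilon>(1) by (intro mult_left_mono L(3)) (auto simp: \<delta>_def)
      also have "\<dots> \<le> e / 2 * norm (x - y)"
        using mult_right_mono[OF \<epsilon>(3), of "norm (x - y)"] by (simp add: mult_ac)
      finally have 1: "norm (g (f x) - g (f y) - g' (f x - f y)) \<le> e / 2 * norm (x - y)" .
      have "norm (g' (f x - f y - f' (x - y))) \<le> K * norm (f x - f y - f' (x - y))"
        by (rule K)
      also have "\<dots> \<le> K * (\<epsilon>2 * norm (x - y))"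
        using xy K(1) by (intro mult_left_mono \<delta>2(2)) (auto simp: \<delta>_def)
      also have "\<dots> \<le> e / 2 * norm (x - y)"
        using mult_right_mono[OF \<epsilon>(4), of "norm (x - y)"] by (simp add: mult_ac)
      finally have 2: "norm (g' (f x - f y - f' (x - y))) \<le> e / 2 * norm (x - y)" .
      have "g' (f x - f y - f' (x - y)) = g' (f x - f y) - g' (f' (x - y))"
        using bounded_linear.linear[OF lin(1)] by (simp add: linear_diff)
      then have "g (f x) - g (f y) - g' (f' (x - y)) =
          (g (f x) - g (f y) - g' (f x - f y)) + g' (f x - f y - f' (x - y))" by simp
      also have "norm \<dots> \<le> e / 2 * norm (x - y) + e / 2 * norm (x - y)"
        by (rule norm_triangle_mono[OF 1 2])
      finally show ?thesis by simp
    qed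
    ultimately show "\<exists>\<delta>>0. \<forall>x\<in>ball a \<delta>. \<forall>y\<in>ball a \<delta>.
        norm (g (f x) - g (f y) - g' (f' (x - y))) \<le> e * norm (x - y)" by blast
  qed
  then show ?thesis unfolding strictly_differentiable_def by blast
qed

lemma strictly_differentiable_Pair:
  assumes "strictly_differentiable f a" "strictly_differentiable g a"
  shows "strictly_differentiable (\<lambda>x. (f x, g x)) a"
proof -
  obtain f' g' where f': "has_strict_derivative f f' a" and g': "has_strict_derivative g g' a"
    using assms unfolding strictly_differentiable_def by blast
  have "has_strict_derivative (\<lambda>x. (f x, g x)) (\<lambda>v. (f' v, g' v)) a"
    unfolding has_strict_derivative_def
  proof (intro conjI allI impI)
    show "bounded_linear (\<lambda>v. (f' v, g' v))"
      using f' g' by (auto simp: has_strict_derivative_def intro: bounded_linear_Pair)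
    fix e :: real assume "e > 0"
    then have e: "e / 2 > 0" by simp
    obtain \<delta>1 where \<delta>1: "\<delta>1 > 0" "\<And>x y. x \<in> ball a \<delta>1 \<Longrightarrow> y \<in> ball a \<delta>1 \<Longrightarrow>
        norm (f x - f y - f' (x - y)) \<le> e / 2 * norm (x - y)"
      using has_strict_derivativeD[OF f' e] by blast
    obtain \<delta>2 where \<delta>2: "\<delta>2 > 0" "\<And>x y. x \<in> ball a \<delta>2 \<Longrightarrow> y \<in> ball a \<delta>2 \<Longrightarrow>
        norm (g x - g y - g' (x - y)) \<le> e / 2 * norm (x - y)"
      using has_strict_derivativeD[OF g' e] by blast
    have "norm ((f x, g x) - (f y, g y) - (f' (x - y), g' (x - y))) \<le> e * norm (x - y)"
      if "x \<in> ball a (min \<delta>1 \<delta>2)" "y \<in> ball a (min \<delta>1 \<delta>2)" for x y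
      using norm_Pair_le[of "f x - f y - f' (x - y)" "g x - g y - g' (x - y)"]
        \<delta>1(2)[of x y] \<delta>2(2)[of x y] that
      by simp
    then show "\<exists>\<delta>>0. \<forall>x\<in>ball a \<delta>. \<forall>y\<in>ball a \<delta>.
        norm ((f x, g x) - (f y, g y) - (f' (x - y), g' (x - y))) \<le> e * norm (x - y)"
      using \<delta>1(1) \<delta>2(1) by (intro exI[of _ "min \<delta>1 \<delta>2"]) auto
  qed
  then show ?thesis unfolding strictly_differentiable_def by blast
qed

lemma strictly_differentiable_mult:
  fixes f g :: "'a::real_normed_vector \<Rightarrow> real"
  assumes "strictly_differentiable f a" "strictly_differentiable g a"
  shows "strictly_differentiable (\<lambda>x. f x * g x) a"
proof -
  have "has_strict_derivative (\<lambda>p::real\<times>real. fst p * snd p)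
      (\<lambda>v. fst c * snd v + snd c * fst v) c" for c
    unfolding has_strict_derivative_def
  proof (intro conjI allI impI)
    show "bounded_linear (\<lambda>v::real\<times>real. fst c * snd v + snd c * fst v)"
      by (intro bounded_linear_add bounded_linear_const_mult bounded_linear_fst bounded_linear_snd)
    fix e :: real assume e: "e > 0"
    have "norm (fst x * snd x - fst y * snd y - (fst c * snd (x - y) + snd c * fst (x - y)))
        \<le> e * norm (x - y)" if "x \<in> ball c (e/2)" "y \<in> ball c (e/2)" for x y
    proof -
      have 1: "\<bar>fst x - fst c\<bar> \<le> e / 2" "\<bar>snd y - snd c\<bar> \<le> e / 2"
        using that dist_fst_le[of x c] dist_snd_le[of y c] by (auto simp: dist_real_def dist_commute)
      have 2: "\<bar>fst x - fst y\<bar> \<le> norm (x - y)" "\<bar>snd x - snd y\<bar> \<le> norm (x - y)"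
        using norm_fst_le[of "fst (x - y)" "snd (x - y)"] norm_snd_le[of "snd (x - y)" "fst (x - y)"]
        unfolding prod.collapse by auto
      have "fst x * snd x - fst y * snd y - (fst c * snd (x - y) + snd c * fst (x - y)) =
          (fst x - fst c) * (snd x - snd y) + (snd y - snd c) * (fst x - fst y)"
        by (simp add: algebra_simps)
      also have "\<bar>\<dots>\<bar> \<le> e / 2 * norm (x - y) + e / 2 * norm (x - y)"
        by (intro order.trans[OF abs_triangle_ineq] add_mono; unfold abs_mult; intro mult_mono 1 2)
          (use e in auto)
      finally show ?thesis by simp
    qed
    then show "\<exists>\<delta>>0. \<forall>x\<in>ball c \<delta>. \<forall>y\<in>ball c \<delta>.
        norm (fst x * snd x - fst y * snd y - (fst c * snd (x - y) + snd c * fst (x - y)))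
        \<le> e * norm (x - y)" using e by (intro exI[of _ "e/2"]) auto
  qed
  then have "strictly_differentiable (\<lambda>p::real\<times>real. fst p * snd p) c" for c
    unfolding strictly_differentiable_def by blast
  from strictly_differentiable_compose[OF this strictly_differentiable_Pair[OF assms]]
  show ?thesis by simp
qed

lemma strictly_differentiable_add:
  assumes "strictly_differentiable f a" "strictly_differentiable g a"
  shows "strictly_differentiable (\<lambda>x. f x + g x) a"
proof -
  have "bounded_linear (\<lambda>p. fst p + snd p)"
    by (intro bounded_linear_add bounded_linear_fst bounded_linear_snd)
  from strictly_differentiable_compose[OF strictly_differentiable_bounded_linear[OF this]
      strictly_differentiable_Pair[OF assms]]
  show ?thesis by simp
qed

lemma strictly_differentiable_minus:
  assumes "strictly_differentiable f a"
  shows "strictly_differentiable (\<lambda>x. - f x) a"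
  by (rule strictly_differentiable_compose[OF strictly_differentiable_bounded_linear assms])
    (intro bounded_linear_minus bounded_linear_ident)

lemma strictly_differentiable_diff:
  assumes "strictly_differentiable f a" "strictly_differentiable g a"
  shows "strictly_differentiable (\<lambda>x. f x - g x) a"
  using strictly_differentiable_add[OF assms(1) strictly_differentiable_minus[OF assms(2)]] by simp

lemma strictly_differentiable_power:
  fixes f :: "'a::real_normed_vector \<Rightarrow> real"
  assumes "strictly_differentiable f a"
  shows "strictly_differentiable (\<lambda>x. f x ^ n) a"
  by (induction n) (auto intro: strictly_differentiable_const strictly_differentiable_mult assms)

text \<open>
  The source of the rules for \<open>inverse\<close> and \<open>powr\<close>: by the mean value inequality,
  subtracting the tangent leaves a function with a small Lipschitz constant near \<open>a\<close>.
\<close>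
lemma strictly_differentiable_C1:
  fixes \<phi> :: "real \<Rightarrow> real"
  assumes "r > 0" "\<And>y. y \<in> ball a r \<Longrightarrow> (\<phi> has_field_derivative \<phi>' y) (at y)" "isCont \<phi>' a"
  shows "strictly_differentiable \<phi> a"
proof -
  have "has_strict_derivative \<phi> (\<lambda>v. \<phi>' a * v) a"
    unfolding has_strict_derivative_def
  proof (intro conjI allI impI)
    show "bounded_linear (\<lambda>v. \<phi>' a * v)" by (rule bounded_linear_mult_right)
    fix e :: real assume "e > 0"
    then obtain d where d: "d > 0" "\<And>y. dist y a < d \<Longrightarrow> dist (\<phi>' y) (\<phi>' a) < e"
      using assms(3) unfolding continuous_at_eps_delta by blast
    let ?S = "ball a (min r d)"
    have "norm ((\<phi> x - \<phi>' a * x) - (\<phi> y - \<phi>' a * y)) \<le> e * norm (x - y)"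
      if "x \<in> ?S" "y \<in> ?S" for x y
    proof (rule field_differentiable_bound[where f' = "\<lambda>y. \<phi>' y - \<phi>' a"])
      fix z assume z: "z \<in> ?S"
      then have "((\<lambda>x. \<phi> x - \<phi>' a * x) has_field_derivative (\<phi>' z - \<phi>' a * 1)) (at z)"
        by (intro derivative_intros assms(2)) auto
      then show "((\<lambda>x. \<phi> x - \<phi>' a * x) has_field_derivative (\<phi>' z - \<phi>' a)) (at z within ?S)"
        by (auto intro: has_field_derivative_at_within)
      show "norm (\<phi>' z - \<phi>' a) \<le> e"
        using d(2)[of z] z by (auto simp: dist_commute dist_norm intro: less_imp_le)
    qed (use that in auto)
    then show "\<exists>\<delta>>0. \<forall>x\<in>ball a \<delta>. \<forall>y\<in>ball a \<delta>.
        norm (\<phi> x - \<phi> y - \<phi>' a * (x - y)) \<le> e * norm (x - y)"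
      using assms(1) d(1) by (intro exI[of _ "min r d"]) (auto simp: algebra_simps)
  qed
  then show ?thesis unfolding strictly_differentiable_def by blast
qed

lemma strictly_differentiable_inverse:
  fixes f :: "'a::real_normed_vector \<Rightarrow> real"
  assumes "strictly_differentiable f a" "f a \<noteq> 0"
  shows "strictly_differentiable (\<lambda>x. inverse (f x)) a"
proof (rule strictly_differentiable_compose[OF _ assms(1)])
  show "strictly_differentiable inverse (f a)"
  proof (rule strictly_differentiable_C1[where r = "\<bar>f a\<bar>" and \<phi>' = "\<lambda>y. - inverse (y ^ 2)"])
    fix y assume "y \<in> ball (f a) \<bar>f a\<bar>"
    then have "y \<noteq> 0" by (auto simp: dist_real_def)
    then show "(inverse has_field_derivative - inverse (y ^ 2)) (at y)"
      by (auto intro!: derivative_eq_intros simp: power2_eq_square)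
  qed (use assms(2) in \<open>auto intro!: continuous_intros\<close>)
qed

lemma strictly_differentiable_divide:
  fixes f g :: "'a::real_normed_vector \<Rightarrow> real"
  assumes "strictly_differentiable f a" "strictly_differentiable g a" "g a \<noteq> 0"
  shows "strictly_differentiable (\<lambda>x. f x / g x) a"
  using strictly_differentiable_mult[OF assms(1) strictly_differentiable_inverse[OF assms(2,3)]]
  by (simp add: divide_inverse)

lemma strictly_differentiable_powr:
  fixes f :: "'a::real_normed_vector \<Rightarrow> real"
  assumes "strictly_differentiable f a" "f a > 0"
  shows "strictly_differentiable (\<lambda>x. f x powr s) a"
proof (rule strictly_differentiable_compose[OF _ assms(1)])
  show "strictly_differentiable (\<lambda>y. y powr s) (f a)"
  proof (rule strictly_differentiable_C1[where r = "f a" and \<phi>' = "\<lambda>y. s * y powr (s - 1)"])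
    fix y assume "y \<in> ball (f a) (f a)"
    then have "y > 0" by (auto simp: dist_real_def)
    then show "((\<lambda>y. y powr s) has_field_derivative s * y powr (s - 1)) (at y)"
      by (rule has_real_derivative_powr)
  qed (use assms(2) in \<open>auto intro!: continuous_intros\<close>)
qed

text \<open>
  Strict differentiability at \<open>a\<close> bounds the difference quotients of all pairs of points near
  \<open>a\<close>, so the function is locally Lipschitz, which on a compact set gives a global constant.
\<close>
lemma strictly_differentiable_imp_lipschitz_on_compact:
  assumes "compact S" "\<And>a. a \<in> S \<Longrightarrow> strictly_differentiable f a"
  obtains L where "L-lipschitz_on S f"
proof -
  have "local_lipschitz {0::real} S (\<lambda>_. f)"
  proof (rule local_lipschitzI)
    fix a assume "a \<in> S"
    then obtain f' where "has_strict_derivative f f' a"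
      using assms(2) unfolding strictly_differentiable_def by blast
    then obtain \<delta> L where *: "\<delta> > 0" "L \<ge> 0"
      "\<And>x y. x \<in> ball a \<delta> \<Longrightarrow> y \<in> ball a \<delta> \<Longrightarrow> norm (f x - f y) \<le> L * norm (x - y)"
      using has_strict_derivative_imp_lipschitz by blast
    have "L-lipschitz_on (cball a (\<delta> / 2) \<inter> S) f"
      using * by (auto intro!: lipschitz_onI simp: dist_norm)
    then show "\<exists>u>0. \<exists>L. \<forall>t\<in>cball t u \<inter> {0}. L-lipschitz_on (cball a u \<inter> S) f" for t :: real
      using *(1) by (intro exI[of _ "\<delta> / 2"]) auto
  qed
  then show ?thesis
    using local_lipschitz_compact_implies_lipschitz[where f = "\<lambda>_. f" and T = "{0::real}" and X = S]
      assms(1) that by auto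
qed

lemmas strictly_differentiable_intros =
  strictly_differentiable_const strictly_differentiable_add strictly_differentiable_minus
  strictly_differentiable_diff strictly_differentiable_mult strictly_differentiable_power
  strictly_differentiable_divide strictly_differentiable_powr strictly_differentiable_Pair

section \<open>Orbits that stay close to a saddle\<close>

text \<open>
  The linearisation at \<open>a\<close> contracts \<open>r\<close>, and in the plane \<open>(q, w)\<close> it
  has the eigenvalues \<open>lp > 0 > lm\<close> with product \<open>- F' (0, 1, 0)\<close>. For the difference of two
  orbits let \<open>\<rho>\<close> be its component \<open>r\<close> and let \<open>W\<close> and \<open>Z\<close> be, up to a factor, its components in the
  plane along the eigenvectors for \<open>lp\<close> and \<open>lm\<close>.
  The form \<open>V = W\<^sup>2 - Z\<^sup>2 - \<kappa> \<rho>\<^sup>2\<close> satisfies \<open>V' \<ge> (m / 2) V\<close>, so \<open>V\<close> would grow exponentially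
  if it were positive at \<open>s = 0\<close>. As both orbits are bounded, \<open>V \<le> 0\<close> at \<open>s = 0\<close>, and thus
  \<open>W\<close> is controlled by \<open>Z\<close> and \<open>\<rho>\<close>.
\<close>
lemma saddle_orbits_in_stable_cone:
  fixes F :: "real \<times> real \<times> real \<Rightarrow> real"
  assumes F: "has_strict_derivative F F' a" and saddle: "F' (0, 1, 0) > 0"
  obtains \<epsilon> \<sigma> K where "\<epsilon> > 0" and
    "\<And>r\<^sub>1 q\<^sub>1 w\<^sub>1 r\<^sub>2 q\<^sub>2 w\<^sub>2.
      (\<And>s. 0 \<le> s \<Longrightarrow> (r\<^sub>1 has_real_derivative - r\<^sub>1 s) (at s) \<and> (q\<^sub>1 has_real_derivative w\<^sub>1 s) (at s) \<and>
        (w\<^sub>1 has_real_derivative F (r\<^sub>1 s, q\<^sub>1 s, w\<^sub>1 s)) (at s) \<and> (r\<^sub>1 s, q\<^sub>1 s, w\<^sub>1 s) \<in> ball a \<epsilon>) \<Longrightarrow>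
      (\<And>s. 0 \<le> s \<Longrightarrow> (r\<^sub>2 has_real_derivative - r\<^sub>2 s) (at s) \<and> (q\<^sub>2 has_real_derivative w\<^sub>2 s) (at s) \<and>
        (w\<^sub>2 has_real_derivative F (r\<^sub>2 s, q\<^sub>2 s, w\<^sub>2 s)) (at s) \<and> (r\<^sub>2 s, q\<^sub>2 s, w\<^sub>2 s) \<in> ball a \<epsilon>) \<Longrightarrow>
      dist (r\<^sub>1 0, q\<^sub>1 0, w\<^sub>1 0) (r\<^sub>2 0, q\<^sub>2 0, w\<^sub>2 0)
        \<le> K * dist (r\<^sub>1 0, w\<^sub>1 0 - \<sigma> * q\<^sub>1 0) (r\<^sub>2 0, w\<^sub>2 0 - \<sigma> * q\<^sub>2 0)"
proof -
  define e D c where "e = F' (1, 0, 0)" and "D = F' (0, 1, 0)" and "c = - F' (0, 0, 1)"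
  have F': "F' (u, v, w) = e * u + D * v - c * w" for u v w
  proof -
    have lin: "linear F'" using F by (simp add: has_strict_derivative_def bounded_linear.linear)
    have "(u, v, w) = u *\<^sub>R (1, 0, 0) + v *\<^sub>R (0, 1, 0) + w *\<^sub>R (0, 0, 1)" by simp
    then have "F' (u, v, w) = F' (u *\<^sub>R (1, 0, 0) + v *\<^sub>R (0, 1, 0) + w *\<^sub>R (0, 0, 1))" by (rule arg_cong)
    also have "\<dots> = u *\<^sub>R F' (1, 0, 0) + v *\<^sub>R F' (0, 1, 0) + w *\<^sub>R F' (0, 0, 1)"
      by (simp only: linear_add[OF lin] linear_scale[OF lin])
    finally have "F' (u, v, w) = u *\<^sub>R F' (1, 0, 0) + v *\<^sub>R F' (0, 1, 0) + w *\<^sub>R F' (0, 0, 1)" .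
    then show ?thesis by (simp add: e_def D_def c_def)
  qed
  have D: "D > 0" using saddle by (simp add: D_def)
  \<comment> \<open>The roots of \<open>\<lambda>\<^sup>2 + c \<lambda> - D = 0\<close>, the eigenvalues in the plane \<open>(q, w)\<close>.\<close>
  define lp lm where "lp = (- c + sqrt (c\<^sup>2 + 4 * D)) / 2" and "lm = (- c - sqrt (c\<^sup>2 + 4 * D)) / 2"
  have "\<bar>c\<bar> < sqrt (c\<^sup>2 + 4 * D)"
    using real_sqrt_less_mono[of "c\<^sup>2" "c\<^sup>2 + 4 * D"] D by simp
  then have l: "lp > 0" "lm < 0" by (auto simp: lp_def lm_def abs_less_iff)
  have lsum: "lp + lm = - c" by (simp add: lp_def lm_def field_simps)
  have lprod: "lp * lm = - D"
  proof -
    have "(sqrt (c\<^sup>2 + 4 * D))\<^sup>2 = c\<^sup>2 + 4 * D" using D by simp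
    then show ?thesis by (simp add: lp_def lm_def algebra_simps power2_eq_square)
  qed
  \<comment> \<open>\<open>\<kappa>\<close> absorbs the coupling of \<open>\<rho>\<close> into \<open>W\<close> and \<open>Z\<close>; \<open>\<eta>\<close> is the admissible nonlinear error.\<close>
  define \<Delta> m \<kappa> C0 \<eta> where "\<Delta> = lp - lm" and "m = min lp (- lm)" and "\<kappa> = m + 4 * e\<^sup>2 / m"
    and "C0 = 2 + 1 / \<Delta>" and "\<eta> = m / (12 * C0)"
  have pos: "\<Delta> > 0" "m > 0" "\<kappa> > 0" "C0 > 0" "\<eta> > 0" "lp \<ge> m" "- lm \<ge> m" "- lm \<le> \<Delta>"
    using l by (auto simp: \<Delta>_def m_def \<kappa>_def C0_def \<eta>_def intro!: add_pos_nonneg divide_pos_pos)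
  obtain \<epsilon> where \<epsilon>: "\<epsilon> > 0" "\<And>x y. x \<in> ball a \<epsilon> \<Longrightarrow> y \<in> ball a \<epsilon> \<Longrightarrow>
      norm (F x - F y - F' (x - y)) \<le> \<eta> * norm (x - y)"
    using has_strict_derivativeD[OF F pos(5)] by blast
  define K where "K = 1 + (2 + sqrt \<kappa>) / \<Delta> + (1 + sqrt \<kappa>) + (2 + sqrt \<kappa>)"
  have norm3: "norm (u, v, w) \<le> \<bar>u\<bar> + \<bar>v\<bar> + \<bar>w\<bar>" for u v w :: real
    using norm_Pair_le[of u "(v, w)"] norm_Pair_le[of v w] by simp
  show ?thesis
  proof (rule that[OF \<epsilon>(1), where K = K and \<sigma> = lp], goal_cases)
    case (1 r\<^sub>1 q\<^sub>1 w\<^sub>1 r\<^sub>2 q\<^sub>2 w\<^sub>2)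
    define \<rho> y \<omega> where "\<rho> s = r\<^sub>1 s - r\<^sub>2 s" and "y s = q\<^sub>1 s - q\<^sub>2 s" and "\<omega> s = w\<^sub>1 s - w\<^sub>2 s" for s
    define E where "E s = F (r\<^sub>1 s, q\<^sub>1 s, w\<^sub>1 s) - F (r\<^sub>2 s, q\<^sub>2 s, w\<^sub>2 s)
      - (e * \<rho> s + D * y s - c * \<omega> s)" for s
    define W Z where "W s = \<omega> s - lm * y s" and "Z s = \<omega> s - lp * y s" for s
    define V where "V s = (W s)\<^sup>2 - (Z s)\<^sup>2 - \<kappa> * (\<rho> s)\<^sup>2" for s
    define N where "N s = (\<rho> s)\<^sup>2 + (W s)\<^sup>2 + (Z s)\<^sup>2" for s
    have y_eq: "y s = (W s - Z s) / \<Delta>" for s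
      using pos(1) by (simp add: W_def Z_def \<Delta>_def field_simps)
    have \<omega>_eq: "\<omega> s = W s + lm * y s" for s by (simp add: W_def)
    have y_le: "\<bar>y s\<bar> \<le> (\<bar>W s\<bar> + \<bar>Z s\<bar>) / \<Delta>" for s
      using pos(1) by (simp add: y_eq divide_right_mono)
    have \<omega>_le: "\<bar>\<omega> s\<bar> \<le> \<bar>W s\<bar> + (\<bar>W s\<bar> + \<bar>Z s\<bar>)" for s
    proof -
      have "\<bar>lm * y s\<bar> \<le> \<Delta> * ((\<bar>W s\<bar> + \<bar>Z s\<bar>) / \<Delta>)"
        unfolding abs_mult using l pos by (intro mult_mono y_le) auto
      then show ?thesis unfolding \<omega>_eq using pos(1) by simp
    qed
    have d\<rho>: "(\<rho> has_real_derivative - \<rho> s) (at s)"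
      and dW: "(W has_real_derivative lp * W s + (e * \<rho> s + E s)) (at s)"
      and dZ: "(Z has_real_derivative lm * Z s + (e * \<rho> s + E s)) (at s)" if "s \<ge> 0" for s
    proof -
      note d = 1(1)[OF that] 1(2)[OF that]
      show "(\<rho> has_real_derivative - \<rho> s) (at s)"
        unfolding \<rho>_def[abs_def] using d by (auto intro!: derivative_eq_intros)
      have dy: "(y has_real_derivative \<omega> s) (at s)"
        unfolding y_def[abs_def] \<omega>_def using d by (auto intro!: derivative_eq_intros)
      have dw: "(\<omega> has_real_derivative (e * \<rho> s + D * y s - c * \<omega> s + E s)) (at s)"
        unfolding \<omega>_def[abs_def] E_def using d by (auto intro!: derivative_eq_intros)
      have c: "c = - lp - lm" and DD: "D = - lp * lm" using lsum lprod by auto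
      show "(W has_real_derivative lp * W s + (e * \<rho> s + E s)) (at s)"
        unfolding W_def[abs_def]
        by (rule derivative_eq_intros dy dw refl)+ (simp add: c DD algebra_simps)
      show "(Z has_real_derivative lm * Z s + (e * \<rho> s + E s)) (at s)"
        unfolding Z_def[abs_def]
        by (rule derivative_eq_intros dy dw refl)+ (simp add: c DD algebra_simps)
    qed
    define V' where "V' s = 2 * W s * (lp * W s + (e * \<rho> s + E s))
      - 2 * Z s * (lm * Z s + (e * \<rho> s + E s)) + 2 * \<kappa> * (\<rho> s)\<^sup>2" for s
    have dV: "(V has_real_derivative V' s) (at s)" if "s \<ge> 0" for s
      unfolding V_def[abs_def] V'_def
      by (rule derivative_eq_intros d\<rho>[OF that] dW[OF that] dZ[OF that] refl)+
        (simp add: algebra_simps power2_eq_square)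
    have growth: "V' s \<ge> m / 2 * V s" if s: "s \<ge> 0" for s
    proof -
      let ?T = "\<bar>\<rho> s\<bar> + \<bar>W s\<bar> + \<bar>Z s\<bar>"
      have "\<bar>E s\<bar> \<le> \<eta> * norm (\<rho> s, y s, \<omega> s)"
        using \<epsilon>(2)[of "(r\<^sub>1 s, q\<^sub>1 s, w\<^sub>1 s)" "(r\<^sub>2 s, q\<^sub>2 s, w\<^sub>2 s)"] 1(1)[OF s] 1(2)[OF s]
        by (simp add: E_def \<rho>_def y_def \<omega>_def F')
      also have "\<dots> \<le> \<eta> * (C0 * ?T)"
      proof (intro mult_left_mono)
        have "norm (\<rho> s, y s, \<omega> s) \<le> \<bar>\<rho> s\<bar> + \<bar>y s\<bar> + \<bar>\<omega> s\<bar>" by (rule norm3)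
        also have "\<dots> \<le> \<bar>\<rho> s\<bar> + (\<bar>W s\<bar> + \<bar>Z s\<bar>) / \<Delta> + (\<bar>W s\<bar> + (\<bar>W s\<bar> + \<bar>Z s\<bar>))"
          by (intro add_mono y_le \<omega>_le) auto
        also have "\<dots> \<le> C0 * ?T"
          using pos(1) by (simp add: C0_def algebra_simps add_divide_distrib)
        finally show "norm (\<rho> s, y s, \<omega> s) \<le> C0 * ?T" .
      qed (use pos in auto)
      also have "\<dots> = m / 12 * ?T" using pos by (simp add: \<eta>_def)
      finally have E: "\<bar>E s\<bar> \<le> m / 12 * ?T" .
      have "\<bar>2 * (W s - Z s) * E s\<bar> \<le> (2 * ?T) * (m / 12 * ?T)"
        unfolding abs_mult using pos(2) by (intro mult_mono E) auto
      also have "\<dots> = m / 6 * ?T\<^sup>2" by (simp add: power2_eq_square)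
      also have "\<dots> \<le> m / 6 * (3 * N s)"
      proof (intro mult_left_mono)
        have "(a + b + c)\<^sup>2 \<le> 3 * (a\<^sup>2 + b\<^sup>2 + c\<^sup>2)" for a b c :: real
          using zero_le_power2[of "a - b"] zero_le_power2[of "b - c"] zero_le_power2[of "a - c"]
          by (simp add: power2_eq_square algebra_simps)
        from this[of "\<bar>\<rho> s\<bar>" "\<bar>W s\<bar>" "\<bar>Z s\<bar>"] show "?T\<^sup>2 \<le> 3 * N s" by (simp add: N_def)
      qed (use pos in auto)
      finally have E2: "\<bar>2 * (W s - Z s) * E s\<bar> \<le> m / 2 * N s" by simp
      \<comment> \<open>Young's inequality for the coupling of \<open>\<rho>\<close> into \<open>W\<close> and \<open>Z\<close>.\<close>
      have young: "2 * x * (e * \<rho> s) \<le> m / 2 * x\<^sup>2 + 2 * e\<^sup>2 / m * (\<rho> s)\<^sup>2" for x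
      proof -
        have "0 \<le> 2 / m * (m / 2 * x - e * \<rho> s)\<^sup>2" using pos(2) by simp
        also have "\<dots> = m / 2 * x\<^sup>2 + 2 * e\<^sup>2 / m * (\<rho> s)\<^sup>2 - 2 * x * (e * \<rho> s)"
          using pos(2) by (simp add: power2_eq_square field_simps)
        finally show ?thesis by simp
      qed
      have arith: "v \<le> v'"
        if "x\<^sub>1 \<le> a + k" "x\<^sub>2 \<le> b + k" "2 * a \<le> \<alpha>" "2 * b \<le> \<beta>"
          "v' = 2 * \<alpha> + 2 * \<beta> + 4 * r + 4 * k - x\<^sub>1 - x\<^sub>2 + E'" "\<bar>E'\<bar> \<le> a + b + r"
          "v \<le> a" "0 \<le> a" "0 \<le> b" "0 \<le> r" "0 \<le> k"
        for x\<^sub>1 x\<^sub>2 a b k \<alpha> \<beta> r E' v v' :: real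
        using that by linarith
      show ?thesis
      proof (rule arith)
        show "2 * (- W s) * (e * \<rho> s) \<le> m / 2 * (W s)\<^sup>2 + 2 * e\<^sup>2 / m * (\<rho> s)\<^sup>2"
          using young[of "- W s"] by simp
        show "2 * Z s * (e * \<rho> s) \<le> m / 2 * (Z s)\<^sup>2 + 2 * e\<^sup>2 / m * (\<rho> s)\<^sup>2"
          by (rule young)
        show "2 * (m / 2 * (W s)\<^sup>2) \<le> lp * (W s)\<^sup>2" "2 * (m / 2 * (Z s)\<^sup>2) \<le> - lm * (Z s)\<^sup>2"
          using mult_right_mono[OF pos(6), of "(W s)\<^sup>2"] mult_right_mono[OF pos(7), of "(Z s)\<^sup>2"]
          by simp_all
        show "V' s = 2 * (lp * (W s)\<^sup>2) + 2 * (- lm * (Z s)\<^sup>2)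
            + 4 * (m / 2 * (\<rho> s)\<^sup>2) + 4 * (2 * e\<^sup>2 / m * (\<rho> s)\<^sup>2)
            - 2 * (- W s) * (e * \<rho> s) - 2 * Z s * (e * \<rho> s) + 2 * (W s - Z s) * E s"
          using pos(2) by (simp add: V'_def \<kappa>_def field_simps power2_eq_square)
        show "\<bar>2 * (W s - Z s) * E s\<bar> \<le> m / 2 * (W s)\<^sup>2 + m / 2 * (Z s)\<^sup>2 + m / 2 * (\<rho> s)\<^sup>2"
          using E2 by (simp add: N_def algebra_simps)
        have "0 \<le> (Z s)\<^sup>2" "0 \<le> \<kappa> * (\<rho> s)\<^sup>2" using pos(3) by auto
        then have "V s \<le> (W s)\<^sup>2" unfolding V_def by linarith
        then show "m / 2 * V s \<le> m / 2 * (W s)\<^sup>2" using pos(2) by (intro mult_left_mono) auto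
      qed (use pos(2) in auto)
    qed
    have "V 0 \<le> 0"
    proof (rule ccontr)
      assume "\<not> V 0 \<le> 0"
      then have V0: "V 0 > 0" by simp
      define B where "B = (2 * \<epsilon> + \<bar>lm\<bar> * (2 * \<epsilon>))\<^sup>2"
      have bound: "V s \<le> B" if "s \<ge> 0" for s
      proof -
        have "dist (r\<^sub>1 s, q\<^sub>1 s, w\<^sub>1 s) (r\<^sub>2 s, q\<^sub>2 s, w\<^sub>2 s) \<le> 2 * \<epsilon>"
          using dist_triangle2[of "(r\<^sub>1 s, q\<^sub>1 s, w\<^sub>1 s)" "(r\<^sub>2 s, q\<^sub>2 s, w\<^sub>2 s)" a] 1(1)[OF that] 1(2)[OF that]
          by (auto simp: dist_commute)
        then have "norm (\<rho> s, y s, \<omega> s) \<le> 2 * \<epsilon>"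
          by (simp add: dist_norm \<rho>_def y_def \<omega>_def)
        then have "\<bar>y s\<bar> \<le> 2 * \<epsilon>" "\<bar>\<omega> s\<bar> \<le> 2 * \<epsilon>"
          using norm_snd_le[of "(y s, \<omega> s)" "\<rho> s"] norm_fst_le[of "y s" "\<omega> s"] norm_snd_le[of "\<omega> s" "y s"]
          by auto
        then have "\<bar>W s\<bar> \<le> 2 * \<epsilon> + \<bar>lm\<bar> * (2 * \<epsilon>)"
          unfolding W_def by (intro order.trans[OF abs_triangle_ineq4] add_mono)
            (auto simp: abs_mult intro: mult_left_mono)
        then have "(W s)\<^sup>2 \<le> B" unfolding B_def
          using \<epsilon>(1) by (subst power2_abs[symmetric], intro power_mono) auto
        moreover have "0 \<le> (Z s)\<^sup>2" "0 \<le> \<kappa> * (\<rho> s)\<^sup>2" using pos by auto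
        ultimately show ?thesis unfolding V_def by linarith
      qed
      have mono: "V 0 * exp (m / 2 * s) \<le> V s" if "s \<ge> 0" for s
      proof -
        have "V 0 * exp (- (m / 2 * 0)) \<le> V s * exp (- (m / 2 * s))"
        proof (rule DERIV_nonneg_imp_nondecreasing[OF that])
          fix t assume t: "0 \<le> t" "t \<le> s"
          have "((\<lambda>s. V s * exp (- (m / 2 * s))) has_real_derivative
              (V' t - m / 2 * V t) * exp (- (m / 2 * t))) (at t)"
            by (rule derivative_eq_intros dV[OF t(1)] refl)+ (simp add: algebra_simps)
          moreover have "(V' t - m / 2 * V t) * exp (- (m / 2 * t)) \<ge> 0"
            using growth[OF t(1)] by simp
          ultimately show "\<exists>y. ((\<lambda>s. V s * exp (- (m / 2 * s))) has_real_derivative y) (at t) \<and> 0 \<le> y"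
            by blast
        qed
        then show ?thesis by (simp add: exp_minus field_simps)
      qed
      \<comment> \<open>A time at which the exponential lower bound exceeds the upper bound \<open>B\<close>.\<close>
      define s where "s = 2 / m * (B / V 0)"
      have "B \<ge> 0" by (simp add: B_def)
      then have s: "s \<ge> 0" using pos(2) V0 by (simp add: s_def)
      have "m / 2 * s = B / V 0" using pos(2) by (simp add: s_def)
      then have "exp (m / 2 * s) \<ge> 1 + B / V 0" using exp_ge_add_one_self[of "m / 2 * s"] by simp
      then have "V 0 * (1 + B / V 0) \<le> V 0 * exp (m / 2 * s)" using V0 by (intro mult_left_mono) auto
      moreover have "V 0 * (1 + B / V 0) = V 0 + B" using V0 by (simp add: field_simps)
      ultimately show False using bound[OF s] mono[OF s] V0 by linarith
    qed
    define d where "d = dist (r\<^sub>1 0, w\<^sub>1 0 - lp * q\<^sub>1 0) (r\<^sub>2 0, w\<^sub>2 0 - lp * q\<^sub>2 0)"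
    have "d = norm (\<rho> 0, Z 0)"
      by (simp add: d_def dist_norm \<rho>_def Z_def y_def \<omega>_def algebra_simps)
    then have d: "\<bar>\<rho> 0\<bar> \<le> d" "\<bar>Z 0\<bar> \<le> d"
      using norm_fst_le[of "\<rho> 0" "Z 0"] norm_snd_le[of "Z 0" "\<rho> 0"] by auto
    have d0: "d \<ge> 0" using d by linarith
    have W: "\<bar>W 0\<bar> \<le> (1 + sqrt \<kappa>) * d"
    proof -
      have "(W 0)\<^sup>2 \<le> (Z 0)\<^sup>2 + \<kappa> * (\<rho> 0)\<^sup>2" using \<open>V 0 \<le> 0\<close> by (simp add: V_def)
      also have "\<dots> \<le> d\<^sup>2 + \<kappa> * d\<^sup>2"
        using d pos(3) by (intro add_mono mult_left_mono) (auto simp: abs_le_square_iff[symmetric])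
      also have "\<dots> \<le> ((1 + sqrt \<kappa>) * d)\<^sup>2"
      proof -
        have "((1 + sqrt \<kappa>) * d)\<^sup>2 = d\<^sup>2 + (sqrt \<kappa>)\<^sup>2 * d\<^sup>2 + 2 * sqrt \<kappa> * d\<^sup>2"
          by (simp add: power2_eq_square algebra_simps)
        then show ?thesis using pos(3) by simp
      qed
      finally show ?thesis
        using d0 pos(3) by (intro power2_le_imp_le[of "\<bar>W 0\<bar>"]) auto
    qed
    have "dist (r\<^sub>1 0, q\<^sub>1 0, w\<^sub>1 0) (r\<^sub>2 0, q\<^sub>2 0, w\<^sub>2 0) = norm (\<rho> 0, y 0, \<omega> 0)"
      by (simp add: dist_norm \<rho>_def y_def \<omega>_def)
    also have "\<dots> \<le> \<bar>\<rho> 0\<bar> + \<bar>y 0\<bar> + \<bar>\<omega> 0\<bar>" by (rule norm3)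
    also have "\<dots> \<le> d + ((2 + sqrt \<kappa>) * d) / \<Delta> + ((1 + sqrt \<kappa>) * d + (2 + sqrt \<kappa>) * d)"
    proof -
      have WZ: "\<bar>W 0\<bar> + \<bar>Z 0\<bar> \<le> (2 + sqrt \<kappa>) * d" using W d by (simp add: algebra_simps)
      have "\<bar>y 0\<bar> \<le> ((2 + sqrt \<kappa>) * d) / \<Delta>"
        using y_le[of 0] divide_right_mono[OF WZ, of \<Delta>] pos(1) by linarith
      then show ?thesis using \<omega>_le[of 0] W WZ d by linarith
    qed
    also have "\<dots> = K * d" by (simp add: K_def algebra_simps)
    finally show ?case by (simp add: d_def)
  qed
qed

section \<open>The forward end of a solution\<close>

text \<open>
  Limits of real functions as \<open>t\<close> increases to \<open>b\<close>, including \<open>b = \<infinity>\<close>, in the convention of interval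
  integrals, but as a filter on the reals.
\<close>
definition forward_end :: "ereal \<Rightarrow> real filter" where
  "forward_end b = filtermap real_of_ereal (at_left b)"

lemma eventually_forward_end:
  assumes "ereal a < b"
  shows "eventually Q (forward_end b) \<longleftrightarrow>
    (\<exists>T. a < T \<and> ereal T < b \<and> (\<forall>t. T < t \<longrightarrow> ereal t < b \<longrightarrow> Q t))"
proof
  assume "eventually Q (forward_end b)"
  then obtain b' where b': "b' < b" "\<And>y. b' < y \<Longrightarrow> y < b \<Longrightarrow> Q (real_of_ereal y)"
    unfolding forward_end_def eventually_filtermap eventually_at_left[OF assms(1)] by auto
  have "max (ereal a) b' < b" using b'(1) assms by simp
  then obtain T where T: "max (ereal a) b' < ereal T" "ereal T < b"
    using ereal_dense2 by blast
  then have aT: "ereal a < ereal T" and bT: "b' < ereal T" by simp_all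
  have "Q t" if "T < t" "ereal t < b" for t
  proof -
    have "b' < ereal t" by (rule order.strict_trans[OF bT]) (use that in simp)
    then show "Q t" using b'(2)[of "ereal t"] that by simp
  qed
  then show "\<exists>T. a < T \<and> ereal T < b \<and> (\<forall>t. T < t \<longrightarrow> ereal t < b \<longrightarrow> Q t)"
    using aT T(2) by auto
next
  assume "\<exists>T. a < T \<and> ereal T < b \<and> (\<forall>t. T < t \<longrightarrow> ereal t < b \<longrightarrow> Q t)"
  then obtain T where T: "ereal T < b" "\<And>t. T < t \<Longrightarrow> ereal t < b \<Longrightarrow> Q t" by blast
  have "Q (real_of_ereal y)" if "ereal T < y" "y < b" for y
    using that T(2) by (cases y) auto
  then show "eventually Q (forward_end b)"
    unfolding forward_end_def eventually_filtermap eventually_at_left[OF T(1)] using T(1) by blast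
qed

lemma forward_end_neq_bot:
  assumes "ereal a < b"
  shows "forward_end b \<noteq> bot"
proof
  assume "forward_end b = bot"
  then have "eventually (\<lambda>_. False) (forward_end b)" by simp
  then obtain T where T: "ereal T < b" "\<And>t. T < t \<Longrightarrow> ereal t < b \<Longrightarrow> False"
    unfolding eventually_forward_end[OF assms] by blast
  obtain u where "ereal T < ereal u" "ereal u < b" using ereal_dense2[OF T(1)] by blast
  then show False using T(2)[of u] by simp
qed

text \<open>
  Lets the size \<open>R\<close> replace the time as independent variable. The inverse is defined on an interval
  that extends beyond \<open>R T\<close>, so that derivatives at \<open>R T\<close> are two-sided.
\<close>
lemma inverse_of_decreasing_to_0:
  fixes R R' :: "real \<Rightarrow> real" and T\<^sub>0 T :: real and b :: ereal
  defines "I \<equiv> {t. T\<^sub>0 < t \<and> ereal t < b}"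
  assumes R: "\<And>t. t \<in> I \<Longrightarrow> (R has_real_derivative R' t) (at t)"
    and neg: "\<And>t. t \<in> I \<Longrightarrow> R' t < 0"
    and to0: "\<And>\<epsilon>. \<epsilon> > 0 \<Longrightarrow> \<exists>t\<in>I. R t < \<epsilon>"
    and T: "T \<in> I"
  obtains \<tau> \<rho>\<^sub>1 where "R T < \<rho>\<^sub>1" "\<tau> (R T) = T"
    "\<And>\<rho>. 0 < \<rho> \<Longrightarrow> \<rho> < \<rho>\<^sub>1 \<Longrightarrow> \<tau> \<rho> \<in> I \<and> R (\<tau> \<rho>) = \<rho> \<and>
      (\<tau> has_real_derivative inverse (R' (\<tau> \<rho>))) (at \<rho>)"
    "\<And>t u. t \<in> I \<Longrightarrow> u \<in> I \<Longrightarrow> t < u \<Longrightarrow> R u < R t"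
proof -
  have between: "u \<in> I" if "s \<in> I" "t \<in> I" "s \<le> u" "u \<le> t" for s t u
    using that by (auto simp: I_def) (meson ereal_less_eq(3) order.strict_trans1)
  have decr: "R t < R s" if "s \<in> I" "t \<in> I" "s < t" for s t
    by (rule DERIV_neg_imp_decreasing[OF that(3)]) (use that R neg between in blast)
  have inj: "inj_on R I"
    by (rule inj_onI) (metis decr linorder_neqE_linordered_idom order_less_irrefl)
  have "open I"
  proof -
    have "I = {T\<^sub>0<..} \<inter> {t. ereal t < b}" by (auto simp: I_def)
    moreover have "open {t. ereal t < b}"
      by (intro open_Collect_less continuous_intros)
    ultimately show ?thesis by auto
  qed
  define \<tau> where "\<tau> = the_inv_into I R"
  have \<tau>: "\<tau> (R t) = t" if "t \<in> I" for t
    unfolding \<tau>_def by (rule the_inv_into_f_f[OF inj that])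
  define T\<^sub>1 where "T\<^sub>1 = (T\<^sub>0 + T) / 2"
  have T1: "T\<^sub>1 \<in> I" "T\<^sub>1 < T"
  proof -
    have "T\<^sub>0 < T" using T by (simp add: I_def)
    then show "T\<^sub>1 < T" by (simp add: T\<^sub>1_def)
    then have "ereal T\<^sub>1 < b" using T by (auto simp: I_def intro: order.strict_trans[of _ "ereal T"])
    then show "T\<^sub>1 \<in> I" using \<open>T\<^sub>0 < T\<close> by (simp add: I_def T\<^sub>1_def)
  qed
  show ?thesis
  proof (rule that[of "R T\<^sub>1" \<tau>])
    fix \<rho> assume \<rho>: "0 < \<rho>" "\<rho> < R T\<^sub>1"
    obtain t\<^sub>2 where t2: "t\<^sub>2 \<in> I" "R t\<^sub>2 < \<rho>" using to0[OF \<rho>(1)] by blast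
    have le: "T\<^sub>1 \<le> t\<^sub>2" using decr[OF t2(1) T1(1)] t2(2) \<rho>(2) by force
    obtain t where t: "T\<^sub>1 \<le> t" "t \<le> t\<^sub>2" "R t = \<rho>"
      using IVT2[of R t\<^sub>2 \<rho> T\<^sub>1] le t2 \<rho>(2) T1(1) between R
      by (meson DERIV_isCont less_imp_le)
    have tI: "t \<in> I" using between[OF T1(1) t2(1)] t by blast
    have "(\<tau> has_real_derivative inverse (R' t)) (at (R t))"
      unfolding has_field_derivative_def
    proof (rule has_derivative_inverse_strong[OF \<open>open I\<close> tI])
      show "(R has_derivative (*) (R' t)) (at t)"
        using R[OF tI] by (simp add: has_field_derivative_def)
      show "(*) (R' t) \<circ> (*) (inverse (R' t)) = id"
        using neg[OF tI] by (auto simp: fun_eq_iff)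
      show "continuous_on I R" using R by (auto intro!: continuous_at_imp_continuous_on DERIV_isCont)
    qed (rule \<tau>)
    then show "\<tau> \<rho> \<in> I \<and> R (\<tau> \<rho>) = \<rho> \<and> (\<tau> has_real_derivative inverse (R' (\<tau> \<rho>))) (at \<rho>)"
      using \<tau>[OF tI] tI t(3) by auto
  qed (use decr T1 T \<tau> in auto)
qed

section \<open>Comparison of solutions over a finite time\<close>

text \<open>
  The squared distance \<open>d\<close> satisfies \<open>d' \<ge> - 2 L d\<close>, so \<open>d * exp (2 L t)\<close> is
  nondecreasing.
\<close>
lemma backward_gronwall:
  fixes x y :: "real \<Rightarrow> 'a::real_inner"
  assumes L: "L-lipschitz_on S v" and T: "0 \<le> T"
    and x: "\<And>t. 0 \<le> t \<Longrightarrow> t \<le> T \<Longrightarrow> x t \<in> S \<and> (x has_vector_derivative v (x t)) (at t)"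
    and y: "\<And>t. 0 \<le> t \<Longrightarrow> t \<le> T \<Longrightarrow> y t \<in> S \<and> (y has_vector_derivative v (y t)) (at t)"
  shows "dist (x 0) (y 0) \<le> exp (L * T) * dist (x T) (y T)"
proof -
  define d where "d t = (x t - y t) \<bullet> (x t - y t)" for t
  define d' where "d' t = 2 * ((x t - y t) \<bullet> (v (x t) - v (y t)))" for t
  have d: "(d has_real_derivative d' t) (at t)" if "0 \<le> t" "t \<le> T" for t
  proof -
    have "((\<lambda>t. x t - y t) has_vector_derivative v (x t) - v (y t)) (at t)"
      using x[OF that] y[OF that] by (intro has_vector_derivative_diff) auto
    then have "((\<lambda>t. x t - y t) has_derivative (\<lambda>h. h *\<^sub>R (v (x t) - v (y t)))) (at t)"
      by (simp add: has_vector_derivative_def)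
    from has_derivative_inner[OF this this]
    show ?thesis
      unfolding d_def[abs_def] d'_def has_field_derivative_def
      by (rule has_derivative_eq_rhs) (auto simp: inner_commute algebra_simps)
  qed
  have ge: "d' t \<ge> - 2 * L * d t" if "0 \<le> t" "t \<le> T" for t
  proof -
    have "\<bar>(x t - y t) \<bullet> (v (x t) - v (y t))\<bar> \<le> norm (x t - y t) * norm (v (x t) - v (y t))"
      by (rule Cauchy_Schwarz_ineq2)
    also have "\<dots> \<le> norm (x t - y t) * (L * norm (x t - y t))"
      using lipschitz_onD[OF L, of "x t" "y t"] x[OF that] y[OF that]
      by (intro mult_left_mono) (auto simp: dist_norm)
    also have "\<dots> = L * d t" by (simp add: d_def power2_norm_eq_inner[symmetric] power2_eq_square)
    finally show ?thesis unfolding d'_def by (simp add: abs_le_iff)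
  qed
  have "d 0 * exp (2 * L * 0) \<le> d T * exp (2 * L * T)"
  proof (rule DERIV_nonneg_imp_nondecreasing[OF T])
    fix t assume t: "0 \<le> t" "t \<le> T"
    have "((\<lambda>t. d t * exp (2 * L * t)) has_real_derivative (d' t + 2 * L * d t) * exp (2 * L * t)) (at t)"
      by (rule derivative_eq_intros d[OF t] refl)+ (simp add: algebra_simps)
    moreover have "(d' t + 2 * L * d t) * exp (2 * L * t) \<ge> 0" using ge[OF t] by simp
    ultimately show "\<exists>y. ((\<lambda>t. d t * exp (2 * L * t)) has_real_derivative y) (at t) \<and> 0 \<le> y" by blast
  qed
  then have "(dist (x 0) (y 0))\<^sup>2 \<le> (dist (x T) (y T))\<^sup>2 * exp (2 * L * T)"
    by (simp add: d_def dist_norm power2_norm_eq_inner)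
  also have "\<dots> = (exp (L * T) * dist (x T) (y T))\<^sup>2"
    by (simp add: power_mult_distrib exp_double[symmetric] mult.assoc)
  finally show ?thesis by (rule power2_le_imp_le) simp
qed

definition phase_box :: "nat \<Rightarrow> phase set" where
  "phase_box n = {1 / real n..real n} \<times> {- real n..real n} \<times> {- real n..real n} \<times> {- real n..real n}"

lemma compact_phase_box: "compact (phase_box n)"
  unfolding phase_box_def by (intro compact_Times compact_Icc)

text \<open>
  The boxes exhaust the phase space, so that countably many Lipschitz constants of the vector field
  suffice.
\<close>
lemma compact_subset_phase_box:
  assumes "compact S" "S \<subseteq> phase_space"
  obtains n where "n > 0" "S \<subseteq> phase_box n"
proof (cases "S = {}")
  case True then show ?thesis using that[of 1] by auto
next
  case False
  obtain r where r: "\<And>p. p \<in> S \<Longrightarrow> norm p \<le> r"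
    using compact_imp_bounded[OF assms(1)] unfolding bounded_iff by blast
  obtain p\<^sub>0 where p0: "p\<^sub>0 \<in> S" "\<And>p. p \<in> S \<Longrightarrow> fst p\<^sub>0 \<le> fst p"
    using continuous_attains_inf[OF assms(1) False continuous_on_fst[OF continuous_on_id]] by blast
  have pos: "fst p\<^sub>0 > 0" using p0(1) assms(2) by (auto simp: phase_space_def)
  obtain n :: nat where n: "real n > max 1 (max r (1 / fst p\<^sub>0))" using reals_Archimedean2 by blast
  show ?thesis
  proof (rule that[of n])
    show "n > 0" using n by simp
    show "S \<subseteq> phase_box n"
    proof
      fix p assume p: "p \<in> S"
      obtain R z P Q where p_eq: "p = (R, z, P, Q)" by (cases p)
      have "\<bar>R\<bar> \<le> r" "\<bar>z\<bar> \<le> r" "\<bar>P\<bar> \<le> r" "\<bar>Q\<bar> \<le> r"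
        using r[OF p] norm_fst_le[of R "(z, P, Q)"] norm_snd_le[of "(z, P, Q)" R]
          norm_fst_le[of z "(P, Q)"] norm_snd_le[of "(P, Q)" z] norm_fst_le[of P Q] norm_snd_le[of Q P]
        by (auto simp: p_eq)
      moreover have "1 / real n \<le> fst p\<^sub>0" using n pos by (simp add: field_simps)
      then have "1 / real n \<le> R" using p0(2)[OF p] by (simp add: p_eq)
      ultimately show "p \<in> phase_box n" using n by (auto simp: phase_box_def p_eq)
    qed
  qed
qed

section \<open>Equations of motion and their homogeneous form\<close>

locale isosceles_schwarzschild =
  fixes M m A A\<^sub>1 B B\<^sub>1 C h \<mu> :: real
  assumes M: "M > 0" and m: "m > 0" and A: "A > 0" and A\<^sub>1: "A\<^sub>1 > 0" and B: "B > 0" and B\<^sub>1: "B\<^sub>1 > 0"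
    and \<mu>_eq: "\<mu> = (2 * M + m) / m"
begin

lemma \<mu>_gt_1: "\<mu> > 1" using M m by (simp add: \<mu>_eq field_simps)

abbreviation "H \<equiv> H_red M m A A\<^sub>1 B B\<^sub>1 C"

text \<open>
  All terms of the Hamiltonian without momenta, including the centrifugal one; the forces below are its
  negative partial derivatives.
\<close>
definition potential :: "real \<Rightarrow> real \<Rightarrow> real" where
  "potential R z = C\<^sup>2 / (M * R\<^sup>2) - A / R - B / R ^ 3
     - 4 * A\<^sub>1 * (R\<^sup>2 + 4 * z\<^sup>2) powr (- (1 / 2)) - 16 * B\<^sub>1 * (R\<^sup>2 + 4 * z\<^sup>2) powr (- (3 / 2))"

definition force_R :: "real \<Rightarrow> real \<Rightarrow> real" where
  "force_R R z = 2 * C\<^sup>2 / (M * R ^ 3) - A / R\<^sup>2 - 3 * B / R ^ 4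
     - 4 * A\<^sub>1 * R * (R\<^sup>2 + 4 * z\<^sup>2) powr (- (3 / 2)) - 48 * B\<^sub>1 * R * (R\<^sup>2 + 4 * z\<^sup>2) powr (- (5 / 2))"

definition force_z :: "real \<Rightarrow> real \<Rightarrow> real" where
  "force_z R z = - 16 * A\<^sub>1 * z * (R\<^sup>2 + 4 * z\<^sup>2) powr (- (3 / 2))
     - 192 * B\<^sub>1 * z * (R\<^sup>2 + 4 * z\<^sup>2) powr (- (5 / 2))"

lemma H_eq: "H (R, z, PR, Pz) = PR\<^sup>2 / M + \<mu> / (4 * M) * Pz\<^sup>2 + potential R z"
proof -
  have "\<mu> / (4 * M) = (2 * M + m) / (4 * M * m)" by (simp add: \<mu>_eq)
  then show ?thesis
    by (simp add: H_red_def potential_def powr_minus_divide distrib_left)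
qed

text \<open>
  Stated along a curve: the partial derivatives of \<open>H\<close> and the conservation of
  energy are both instances.
\<close>
lemma DERIV_potential:
  assumes R: "(R has_real_derivative R') (at t)" and z: "(z has_real_derivative z') (at t)"
    and pos: "R t > 0"
  shows "((\<lambda>t. potential (R t) (z t)) has_real_derivative
    - (force_R (R t) (z t) * R' + force_z (R t) (z t) * z')) (at t)"
proof -
  let ?S = "\<lambda>t. (R t)\<^sup>2 + 4 * (z t)\<^sup>2"
  have S: "?S t > 0" using pos by (simp add: add_pos_nonneg)
  have dS: "(?S has_real_derivative 2 * R t * R' + 8 * z t * z') (at t)"
    by (rule derivative_eq_intros R z refl)+ simp
  have dp: "((\<lambda>t. ?S t powr s) has_real_derivative
      s * ?S t powr (s - 1) * (2 * R t * R' + 8 * z t * z')) (at t)" for s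
    by (rule DERIV_chain2[OF has_real_derivative_powr[OF S] dS])
  have i1: "((\<lambda>t. C\<^sup>2 / (M * (R t)\<^sup>2)) has_real_derivative - (2 * C\<^sup>2 / (M * R t ^ 3)) * R') (at t)"
    using M pos by (auto intro!: derivative_eq_intros R simp: field_simps power2_eq_square power3_eq_cube)
  have i2: "((\<lambda>t. A / R t) has_real_derivative - (A / (R t)\<^sup>2) * R') (at t)"
    using pos by (auto intro!: derivative_eq_intros R simp: field_simps power2_eq_square)
  have i3: "((\<lambda>t. B / R t ^ 3) has_real_derivative - (3 * B / R t ^ 4) * R') (at t)"
    using pos by (auto intro!: derivative_eq_intros R simp: field_simps eval_nat_numeral)
  have e: "- (1 / 2) - 1 = - (3 / 2 :: real)" "- (3 / 2) - 1 = - (5 / 2 :: real)" by auto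
  show ?thesis
    unfolding potential_def
    by (rule DERIV_cong[OF DERIV_diff[OF DERIV_diff[OF DERIV_diff[OF DERIV_diff[OF i1 i2] i3]
          DERIV_cmult[OF dp]] DERIV_cmult[OF dp]]])
      (simp add: force_R_def force_z_def e algebra_simps add_divide_distrib)
qed

lemma hamiltonian_vector_field_H:
  assumes "R > 0"
  shows "hamiltonian_vector_field H (R, z, PR, Pz)
    = (2 * PR / M, \<mu> * Pz / (2 * M), force_R R z, force_z R z)"
proof -
  have "((\<lambda>p. H (R, z, p, Pz)) has_field_derivative 2 * PR / M) (at PR)"
    unfolding H_eq using M by (auto intro!: derivative_eq_intros)
  moreover have "((\<lambda>p. H (R, z, PR, p)) has_field_derivative \<mu> * Pz / (2 * M)) (at Pz)"
    unfolding H_eq using M by (auto intro!: derivative_eq_intros)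
  moreover have "((\<lambda>q. H (q, z, PR, Pz)) has_field_derivative - force_R R z) (at R)"
    unfolding H_eq
    using DERIV_potential[of "\<lambda>q. q" 1 R "\<lambda>_. z" 0] assms
    by (auto intro!: derivative_eq_intros)
  moreover have "((\<lambda>q. H (R, q, PR, Pz)) has_field_derivative - force_z R z) (at z)"
    unfolding H_eq
    using DERIV_potential[of "\<lambda>_. R" 0 z "\<lambda>q. q" 1] assms
    by (auto intro!: derivative_eq_intros)
  ultimately show ?thesis
    unfolding hamiltonian_vector_field_def by (simp add: DERIV_imp_deriv)
qed

text \<open>
  The forces multiplied by \<open>R ^ 4\<close>, and the kinetic energy on the level \<open>h\<close> multiplied by \<open>R ^ 3\<close>, as functions of
  \<open>R\<close> and the shape \<open>q = z / R\<close>. In this form they remain regular at \<open>R = 0\<close>.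
\<close>
definition N\<^sub>R :: "real \<Rightarrow> real \<Rightarrow> real" where
  "N\<^sub>R R q = 2 * C\<^sup>2 * R / M - A * R\<^sup>2 - 3 * B
     - 4 * A\<^sub>1 * R\<^sup>2 * (1 + 4 * q\<^sup>2) powr (- (3 / 2)) - 48 * B\<^sub>1 * (1 + 4 * q\<^sup>2) powr (- (5 / 2))"

definition N\<^sub>z :: "real \<Rightarrow> real \<Rightarrow> real" where
  "N\<^sub>z R q = - 16 * q * (A\<^sub>1 * R\<^sup>2 * (1 + 4 * q\<^sup>2) powr (- (3 / 2))
     + 12 * B\<^sub>1 * (1 + 4 * q\<^sup>2) powr (- (5 / 2)))"

definition \<Phi> :: "real \<Rightarrow> real \<Rightarrow> real" where
  "\<Phi> R q = h * R ^ 3 + A * R\<^sup>2 + B + 4 * A\<^sub>1 * R\<^sup>2 * (1 + 4 * q\<^sup>2) powr (- (1 / 2))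
     + 16 * B\<^sub>1 * (1 + 4 * q\<^sup>2) powr (- (3 / 2)) - C\<^sup>2 * R / M"

lemma powr_homogeneous:
  assumes "R > 0"
  shows "(R\<^sup>2 + 4 * z\<^sup>2) powr (- (real k / 2)) = (1 + 4 * (z / R)\<^sup>2) powr (- (real k / 2)) / R ^ k"
proof -
  have "R\<^sup>2 + 4 * z\<^sup>2 = R\<^sup>2 * (1 + 4 * (z / R)\<^sup>2)" using assms by (simp add: field_simps)
  then have "(R\<^sup>2 + 4 * z\<^sup>2) powr (- (real k / 2))
      = (R\<^sup>2) powr (- (real k / 2)) * (1 + 4 * (z / R)\<^sup>2) powr (- (real k / 2))"
    by (simp add: powr_mult)
  also have "(R\<^sup>2) powr (- (real k / 2)) = R powr (- real k)"
    using assms by (simp add: powr_powr flip: powr_numeral)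
  also have "\<dots> = 1 / R ^ k" using assms by (simp add: powr_minus powr_realpow divide_inverse)
  finally show ?thesis by simp
qed

lemma force_R_eq:
  assumes R: "R > 0"
  shows "force_R R z = N\<^sub>R R (z / R) / R ^ 4"
proof -
  define X Y where "X = (1 + 4 * (z / R)\<^sup>2) powr (- (3 / 2))"
    and "Y = (1 + 4 * (z / R)\<^sup>2) powr (- (5 / 2))"
  have "(R\<^sup>2 + 4 * z\<^sup>2) powr (- (3 / 2)) = X / R ^ 3" "(R\<^sup>2 + 4 * z\<^sup>2) powr (- (5 / 2)) = Y / R ^ 5"
    using powr_homogeneous[OF R, of z 3] powr_homogeneous[OF R, of z 5] by (simp_all add: X_def Y_def)
  then have "force_R R z = 2 * C\<^sup>2 / (M * R ^ 3) - A / R\<^sup>2 - 3 * B / R ^ 4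
      - 4 * A\<^sub>1 * R * (X / R ^ 3) - 48 * B\<^sub>1 * R * (Y / R ^ 5)"
    by (simp add: force_R_def)
  also have "\<dots> = (2 * C\<^sup>2 * R / M - A * R\<^sup>2 - 3 * B - 4 * A\<^sub>1 * R\<^sup>2 * X - 48 * B\<^sub>1 * Y) / R ^ 4"
    using R M by (simp add: field_simps eval_nat_numeral)
  finally show ?thesis by (simp add: N\<^sub>R_def X_def Y_def)
qed

lemma force_z_eq:
  assumes R: "R > 0"
  shows "force_z R z = N\<^sub>z R (z / R) / R ^ 4"
proof -
  define X Y where "X = (1 + 4 * (z / R)\<^sup>2) powr (- (3 / 2))"
    and "Y = (1 + 4 * (z / R)\<^sup>2) powr (- (5 / 2))"
  have "(R\<^sup>2 + 4 * z\<^sup>2) powr (- (3 / 2)) = X / R ^ 3" "(R\<^sup>2 + 4 * z\<^sup>2) powr (- (5 / 2)) = Y / R ^ 5"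
    using powr_homogeneous[OF R, of z 3] powr_homogeneous[OF R, of z 5] by (simp_all add: X_def Y_def)
  then have "force_z R z = - 16 * A\<^sub>1 * z * (X / R ^ 3) - 192 * B\<^sub>1 * z * (Y / R ^ 5)"
    by (simp add: force_z_def)
  also have "\<dots> = (- 16 * (z / R) * (A\<^sub>1 * R\<^sup>2 * X + 12 * B\<^sub>1 * Y)) / R ^ 4"
    using R by (simp add: field_simps eval_nat_numeral)
  finally show ?thesis by (simp add: N\<^sub>z_def X_def Y_def)
qed

lemma energy_eq:
  assumes R: "R > 0" and "H (R, z, P, Q) = h"
  shows "P\<^sup>2 + \<mu> / 4 * Q\<^sup>2 = M * \<Phi> R (z / R) / R ^ 3"
proof -
  define X Y where "X = (1 + 4 * (z / R)\<^sup>2) powr (- (1 / 2))"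
    and "Y = (1 + 4 * (z / R)\<^sup>2) powr (- (3 / 2))"
  have XY: "(R\<^sup>2 + 4 * z\<^sup>2) powr (- (1 / 2)) = X / R" "(R\<^sup>2 + 4 * z\<^sup>2) powr (- (3 / 2)) = Y / R ^ 3"
    using powr_homogeneous[OF R, of z 1] powr_homogeneous[OF R, of z 3] by (simp_all add: X_def Y_def)
  have "h = P\<^sup>2 / M + \<mu> / (4 * M) * Q\<^sup>2 + potential R z" using assms by (simp add: H_eq)
  then have "P\<^sup>2 + \<mu> / 4 * Q\<^sup>2 = M * (h - potential R z)" using M by (simp add: field_simps)
  also have "h - potential R z = h - (C\<^sup>2 / (M * R\<^sup>2) - A / R - B / R ^ 3
     - 4 * A\<^sub>1 * (X / R) - 16 * B\<^sub>1 * (Y / R ^ 3))" unfolding potential_def XY ..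
  also have "\<dots> = (h * R ^ 3 + A * R\<^sup>2 + B + 4 * A\<^sub>1 * R\<^sup>2 * X + 16 * B\<^sub>1 * Y - C\<^sup>2 * R / M) / R ^ 3"
    using R M by (simp add: field_simps eval_nat_numeral)
  also have "\<dots> = \<Phi> R (z / R) / R ^ 3" by (simp add: \<Phi>_def X_def Y_def)
  finally show ?thesis by simp
qed

section \<open>Orbits with the size as independent variable\<close>

definition orbit ::
  "real set \<Rightarrow> (real \<Rightarrow> real) \<Rightarrow> (real \<Rightarrow> real) \<Rightarrow> (real \<Rightarrow> real) \<Rightarrow> (real \<Rightarrow> real) \<Rightarrow> bool" where
  "orbit J R z P Q \<longleftrightarrow> (\<forall>t\<in>J. R t > 0 \<and>
     (R has_real_derivative 2 * P t / M) (at t) \<and>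
     (z has_real_derivative \<mu> * Q t / (2 * M)) (at t) \<and>
     (P has_real_derivative force_R (R t) (z t)) (at t) \<and>
     (Q has_real_derivative force_z (R t) (z t)) (at t) \<and>
     H (R t, z t, P t, Q t) = h)"

lemma orbitD:
  assumes "orbit J R z P Q" "t \<in> J"
  shows "R t > 0" "(R has_real_derivative 2 * P t / M) (at t)"
    "(z has_real_derivative \<mu> * Q t / (2 * M)) (at t)"
    "(P has_real_derivative force_R (R t) (z t)) (at t)"
    "(Q has_real_derivative force_z (R t) (z t)) (at t)"
    "H (R t, z t, P t, Q t) = h"
  using assms unfolding orbit_def by auto

lemma orbit_subset: "orbit J R z P Q \<Longrightarrow> I \<subseteq> J \<Longrightarrow> orbit I R z P Q"
  unfolding orbit_def by blast

text \<open>
  The contributions of potential and kinetic energy to the derivative of \<open>H\<close> cancel, so \<open>H\<close> keeps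
  its value at time \<open>0\<close>.
\<close>
lemma orbit_of_solution:
  assumes sol: "is_solution H a b x" and 0: "a < 0" "0 < b" "H (x 0) = h"
  shows "orbit (einterval a b) (\<lambda>t. fst (x t)) (\<lambda>t. fst (snd (x t)))
    (\<lambda>t. fst (snd (snd (x t)))) (\<lambda>t. snd (snd (snd (x t))))"
proof -
  let ?R = "\<lambda>t. fst (x t)" and ?z = "\<lambda>t. fst (snd (x t))"
    and ?P = "\<lambda>t. fst (snd (snd (x t)))" and ?Q = "\<lambda>t. snd (snd (snd (x t)))"
  have x_eq: "x t = (?R t, ?z t, ?P t, ?Q t)" for t by simp
  have pos: "?R t > 0" if "t \<in> einterval a b" for t
  proof -
    have "x t \<in> phase_space" using sol that unfolding is_solution_def by blast
    then show ?thesis by (cases "x t") (auto simp: phase_space_def)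
  qed
  have d: "(x has_vector_derivative (2 * ?P t / M, \<mu> * ?Q t / (2 * M),
      force_R (?R t) (?z t), force_z (?R t) (?z t))) (at t)" if "t \<in> einterval a b" for t
  proof -
    have "(x has_vector_derivative hamiltonian_vector_field H (x t)) (at t)"
      using sol that unfolding is_solution_def by blast
    then show ?thesis using hamiltonian_vector_field_H[OF pos[OF that]] x_eq[of t] by metis
  qed
  have c: "(?R has_real_derivative 2 * ?P t / M) (at t)"
    "(?z has_real_derivative \<mu> * ?Q t / (2 * M)) (at t)"
    "(?P has_real_derivative force_R (?R t) (?z t)) (at t)"
    "(?Q has_real_derivative force_z (?R t) (?z t)) (at t)" if t: "t \<in> einterval a b" for t
  proof -
    note snd = bounded_linear.has_vector_derivative[OF bounded_linear_snd]
    note fst = bounded_linear.has_vector_derivative[OF bounded_linear_fst]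
    show "(?R has_real_derivative 2 * ?P t / M) (at t)"
      using fst[OF d[OF t]] by (simp add: has_real_derivative_iff_has_vector_derivative)
    show "(?z has_real_derivative \<mu> * ?Q t / (2 * M)) (at t)"
      using fst[OF snd[OF d[OF t]]] by (simp add: has_real_derivative_iff_has_vector_derivative)
    show "(?P has_real_derivative force_R (?R t) (?z t)) (at t)"
      using fst[OF snd[OF snd[OF d[OF t]]]] by (simp add: has_real_derivative_iff_has_vector_derivative)
    show "(?Q has_real_derivative force_z (?R t) (?z t)) (at t)"
      using snd[OF snd[OF snd[OF d[OF t]]]] by (simp add: has_real_derivative_iff_has_vector_derivative)
  qed
  have "((\<lambda>t. H (?R t, ?z t, ?P t, ?Q t)) has_real_derivative 0) (at t)" if t: "t \<in> einterval a b" for t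
  proof -
    have 1: "((\<lambda>t. (?P t)\<^sup>2 / M) has_real_derivative 2 * ?P t * force_R (?R t) (?z t) / M) (at t)"
      by (rule DERIV_cong[OF DERIV_cdivide[OF DERIV_power[OF c(3)[OF t], of 2]]]) simp
    have 2: "((\<lambda>t. \<mu> / (4 * M) * (?Q t)\<^sup>2) has_real_derivative
        \<mu> / (4 * M) * (2 * ?Q t * force_z (?R t) (?z t))) (at t)"
      by (rule DERIV_cong[OF DERIV_cmult[OF DERIV_power[OF c(4)[OF t], of 2]]]) simp
    show ?thesis unfolding H_eq
      by (rule DERIV_cong[OF DERIV_add[OF DERIV_add[OF 1 2] DERIV_potential[OF c(1,2)[OF t] pos[OF t]]]])
        (use M in \<open>simp add: field_simps\<close>)
  qed
  moreover have "convex (einterval a b)"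
    unfolding is_interval_convex_1[symmetric] is_interval_1
  proof (intro ballI allI impI)
    fix s u t assume su: "s \<in> einterval a b" "u \<in> einterval a b" and "s \<le> t \<and> t \<le> u"
    then have "ereal s \<le> ereal t" "ereal t \<le> ereal u" by auto
    with su show "t \<in> einterval a b"
      unfolding einterval_iff by (meson order.strict_trans1 order.strict_trans2)
  qed
  ultimately have "\<exists>k. \<forall>t\<in>einterval a b. H (?R t, ?z t, ?P t, ?Q t) = k"
    by (intro has_field_derivative_zero_constant) (auto intro: has_field_derivative_at_within)
  then obtain k where k: "\<And>t. t \<in> einterval a b \<Longrightarrow> H (?R t, ?z t, ?P t, ?Q t) = k" by blast
  have "0 \<in> einterval a b" using 0 by (simp add: einterval_def zero_ereal_def)
  then have "k = h" using k[of 0] 0(3) x_eq[of 0] by metis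
  then show ?thesis
    unfolding orbit_def using c k pos by blast
qed

text \<open>
  The right-hand side \<open>F\<close> of \<open>w' = F (R, q, w)\<close> with respect to \<open>s = - ln R\<close>. It is
  \<open>w - (\<mu> / 4) p'\<close> for the slope \<open>p = P\<^sub>z / P\<^sub>R = (4 / \<mu>) (q - w)\<close>; the momenta have been
  eliminated by the energy relation.
\<close>
definition shape_field :: "real \<times> real \<times> real \<Rightarrow> real" where
  "shape_field = (\<lambda>(R, q, w). w + (1 + 4 / \<mu> * (q - w)\<^sup>2)
     * (\<mu> / 4 * N\<^sub>z R q - (q - w) * N\<^sub>R R q) / (2 * \<Phi> R q))"

lemma orbit_\<Phi>:
  assumes "orbit J R z P Q" "t \<in> J"
  shows "(P t)\<^sup>2 + \<mu> / 4 * (Q t)\<^sup>2 = M * \<Phi> (R t) (z t / R t) / R t ^ 3"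
  using energy_eq orbitD[OF assms] by blast

text \<open>
  The time change \<open>\<sigma> s\<close> is the moment at which \<open>R\<close> has shrunk by the factor \<open>exp (- s)\<close>. It
  exists for all \<open>s \<ge> 0\<close> because \<open>R\<close> decreases to \<open>0\<close>.
\<close>
lemma orbit_as_graph_over_size:
  fixes R z P Q :: "real \<Rightarrow> real" and T\<^sub>0 T :: real and b :: ereal
  defines "I \<equiv> {t. T\<^sub>0 < t \<and> ereal t < b}"
  defines "w \<equiv> \<lambda>t. z t / R t - \<mu> / 4 * (Q t / P t)"
  assumes orb: "orbit I R z P Q" and neg: "\<And>t. t \<in> I \<Longrightarrow> P t < 0"
    and to0: "\<And>\<epsilon>. \<epsilon> > 0 \<Longrightarrow> \<exists>t\<in>I. R t < \<epsilon>" and T: "T \<in> I"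
  obtains \<sigma> where "\<sigma> 0 = T"
    "\<And>s. 0 \<le> s \<Longrightarrow> \<sigma> s \<in> I"
    "\<And>s. 0 \<le> s \<Longrightarrow> ((\<lambda>s. R (\<sigma> s)) has_real_derivative - R (\<sigma> s)) (at s)"
    "\<And>s. 0 \<le> s \<Longrightarrow> ((\<lambda>s. z (\<sigma> s) / R (\<sigma> s)) has_real_derivative w (\<sigma> s)) (at s)"
    "\<And>s. 0 \<le> s \<Longrightarrow> ((\<lambda>s. w (\<sigma> s)) has_real_derivative
       shape_field (R (\<sigma> s), z (\<sigma> s) / R (\<sigma> s), w (\<sigma> s))) (at s)"
proof -
  note o = orbitD[OF orb]
  have R'_neg: "2 * P t / M < 0" if "t \<in> I" for t
    using neg[OF that] M by (simp add: divide_neg_pos)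
  obtain \<tau> \<rho>\<^sub>1 where \<rho>1: "R T < \<rho>\<^sub>1" and \<tau>T: "\<tau> (R T) = T" and
    \<tau>: "\<And>\<rho>. 0 < \<rho> \<Longrightarrow> \<rho> < \<rho>\<^sub>1 \<Longrightarrow> \<tau> \<rho> \<in> I \<and> R (\<tau> \<rho>) = \<rho> \<and>
      (\<tau> has_real_derivative inverse (2 * P (\<tau> \<rho>) / M)) (at \<rho>)"
    using inverse_of_decreasing_to_0[of T\<^sub>0 b R "\<lambda>t. 2 * P t / M" T, folded I_def, OF o(2) R'_neg to0 T]
    by metis
  define \<sigma> where "\<sigma> s = \<tau> (R T * exp (- s))" for s
  have r: "0 < R T * exp (- s)" "R T * exp (- s) < \<rho>\<^sub>1" if "0 \<le> s" for s
  proof -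
    show "0 < R T * exp (- s)" using o(1)[OF T] by simp
    have "R T * exp (- s) \<le> R T * 1" using o(1)[OF T] that by (intro mult_left_mono) auto
    then show "R T * exp (- s) < \<rho>\<^sub>1" using \<rho>1 by simp
  qed
  have \<sigma>I: "\<sigma> s \<in> I" and R\<sigma>: "R (\<sigma> s) = R T * exp (- s)" if "0 \<le> s" for s
    using \<tau>[OF r[OF that]] by (auto simp: \<sigma>_def)
  have d\<sigma>: "(\<sigma> has_real_derivative - (R (\<sigma> s) * M / (2 * P (\<sigma> s)))) (at s)" if s: "0 \<le> s" for s
  proof -
    have "((\<lambda>s. R T * exp (- s)) has_real_derivative - (R T * exp (- s))) (at s)"
      by (auto intro!: derivative_eq_intros)
    moreover have "(\<tau> has_real_derivative inverse (2 * P (\<sigma> s) / M)) (at (R T * exp (- s)))"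
      using \<tau>[OF r[OF s]] by (simp add: \<sigma>_def)
    ultimately have "((\<lambda>s. \<tau> (R T * exp (- s))) has_real_derivative
        inverse (2 * P (\<sigma> s) / M) * - (R T * exp (- s))) (at s)"
      by (rule DERIV_chain2[rotated])
    then show ?thesis
      unfolding \<sigma>_def[abs_def, symmetric] R\<sigma>[OF s] by (simp add: field_simps)
  qed
  show ?thesis
  proof (rule that[of \<sigma>])
    show "\<sigma> 0 = T" by (simp add: \<sigma>_def \<tau>T)
  next
    fix s :: real assume s: "0 \<le> s"
    define t where "t = \<sigma> s"
    have t: "t \<in> I" using \<sigma>I[OF s] by (simp add: t_def)
    note d = o[OF t]
    have P: "P t \<noteq> 0" "R t \<noteq> 0" using neg[OF t] d(1) by auto
    show "\<sigma> s \<in> I" by (rule \<sigma>I[OF s])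
    note chain = DERIV_chain2[OF _ d\<sigma>[OF s], folded t_def]
    show "((\<lambda>s. R (\<sigma> s)) has_real_derivative - R (\<sigma> s)) (at s)"
      using chain[OF d(2)] P M by (simp add: t_def)
    have dq: "((\<lambda>t. z t / R t) has_real_derivative
        \<mu> * Q t / (2 * M) / R t - z t * (2 * P t / M) / (R t)\<^sup>2) (at t)"
      by (rule derivative_eq_intros d P refl)+ (use P in \<open>simp add: field_simps power2_eq_square\<close>)
    have q: "((\<lambda>s. z (\<sigma> s) / R (\<sigma> s)) has_real_derivative w t) (at s)"
      using chain[OF dq] by (rule DERIV_cong)
        (use P M in \<open>simp add: w_def field_simps power2_eq_square\<close>)
    then show "((\<lambda>s. z (\<sigma> s) / R (\<sigma> s)) has_real_derivative w (\<sigma> s)) (at s)" by (simp add: t_def)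
    have dp: "((\<lambda>t. Q t / P t) has_real_derivative
        (force_z (R t) (z t) - Q t / P t * force_R (R t) (z t)) / P t) (at t)"
      by (rule derivative_eq_intros d P refl)+ (use P in \<open>simp add: field_simps power2_eq_square\<close>)
    define q\<^sub>0 p where "q\<^sub>0 = z t / R t" and "p = Q t / P t"
    have w: "w t = q\<^sub>0 - \<mu> / 4 * p" by (simp add: w_def q\<^sub>0_def p_def)
    have Q: "Q t = p * P t" using P by (simp add: p_def)
    have E: "(1 + \<mu> / 4 * p\<^sup>2) * ((P t)\<^sup>2 * R t ^ 3) = M * \<Phi> (R t) q\<^sub>0"
      using orbit_\<Phi>[OF orb t] P unfolding q\<^sub>0_def[symmetric] Q
      by (simp add: field_simps power_mult_distrib)
    have \<mu>pos: "\<mu> > 0" using \<mu>_gt_1 by simp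
    have \<Phi>pos: "\<Phi> (R t) q\<^sub>0 \<noteq> 0"
    proof
      assume "\<Phi> (R t) q\<^sub>0 = 0"
      then have "1 + \<mu> / 4 * p\<^sup>2 = 0" using E P by simp
      moreover have "\<mu> / 4 * p\<^sup>2 \<ge> 0" using \<mu>pos by simp
      ultimately show False by linarith
    qed
    define X where "X = N\<^sub>z (R t) q\<^sub>0 - p * N\<^sub>R (R t) q\<^sub>0"
    \<comment> \<open>The derivative of \<open>P\<^sub>z / P\<^sub>R\<close> with respect to \<open>s\<close>, with \<open>P\<^sub>R\<^sup>2 R\<^sup>3\<close> replaced by means of \<open>E\<close>.\<close>
    have slope: "(force_z (R t) (z t) - p * force_R (R t) (z t)) / P t * - (R t * M / (2 * P t))
        = - (1 + \<mu> / 4 * p\<^sup>2) * X / (2 * \<Phi> (R t) q\<^sub>0)"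
    proof -
      have "(force_z (R t) (z t) - p * force_R (R t) (z t)) / P t * - (R t * M / (2 * P t))
          = - (M * X) / (2 * ((P t)\<^sup>2 * R t ^ 3))"
        using P d(1) by (simp add: force_z_eq force_R_eq q\<^sub>0_def[symmetric] X_def field_simps eval_nat_numeral)
      also have "\<dots> = - (1 + \<mu> / 4 * p\<^sup>2) * (M * X) / (2 * ((1 + \<mu> / 4 * p\<^sup>2) * ((P t)\<^sup>2 * R t ^ 3)))"
      proof -
        have "1 + \<mu> / 4 * p\<^sup>2 \<noteq> 0" using E \<Phi>pos M by auto
        moreover have "- a / (2 * c) = - k * a / (2 * (k * c))" if "k \<noteq> 0" for a c k :: real
          using that by simp
        ultimately show ?thesis by blast
      qed
      also have "\<dots> = - (1 + \<mu> / 4 * p\<^sup>2) * (M * X) / (2 * (M * \<Phi> (R t) q\<^sub>0))" unfolding E ..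
      also have "\<dots> = - (1 + \<mu> / 4 * p\<^sup>2) * X / (2 * \<Phi> (R t) q\<^sub>0)" using M by simp
      finally show ?thesis .
    qed
    have w\<sigma>: "(\<lambda>s. w (\<sigma> s)) = (\<lambda>s. z (\<sigma> s) / R (\<sigma> s) - \<mu> / 4 * (Q (\<sigma> s) / P (\<sigma> s)))"
      by (simp add: w_def)
    have "((\<lambda>s. w (\<sigma> s)) has_real_derivative
        w t - \<mu> / 4 * (- (1 + \<mu> / 4 * p\<^sup>2) * X / (2 * \<Phi> (R t) q\<^sub>0))) (at s)"
      unfolding w\<sigma>
      by (rule DERIV_diff[OF q DERIV_cmult[OF chain[OF dp, folded p_def, unfolded slope]]])
    also have "w t - \<mu> / 4 * (- (1 + \<mu> / 4 * p\<^sup>2) * X / (2 * \<Phi> (R t) q\<^sub>0))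
        = shape_field (R t, q\<^sub>0, w t)"
    proof -
      have p: "\<mu> / 4 * p = q\<^sub>0 - w t" by (simp add: w)
      have "4 / \<mu> * (q\<^sub>0 - w t)\<^sup>2 = \<mu> / 4 * p\<^sup>2"
        unfolding p[symmetric] using \<mu>pos by (simp add: power2_eq_square)
      moreover have "\<mu> / 4 * N\<^sub>z (R t) q\<^sub>0 - (q\<^sub>0 - w t) * N\<^sub>R (R t) q\<^sub>0 = \<mu> / 4 * X"
        unfolding p[symmetric] X_def by (simp add: algebra_simps)
      moreover have "w t - \<mu> / 4 * (- k * X / (2 * \<Phi> (R t) q\<^sub>0)) = w t + k * (\<mu> / 4 * X) / (2 * \<Phi> (R t) q\<^sub>0)" for k
        by simp
      ultimately show ?thesis
        unfolding shape_field_def prod.case by (simp only:)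
    qed
    finally show "((\<lambda>s. w (\<sigma> s)) has_real_derivative
       shape_field (R (\<sigma> s), z (\<sigma> s) / R (\<sigma> s), w (\<sigma> s))) (at s)"
      by (simp add: t_def q\<^sub>0_def)
  qed
qed

section \<open>Limits at a triple collision\<close>

lemma N\<^sub>R_neg:
  assumes "0 \<le> R" "2 * C\<^sup>2 * R / M \<le> 2 * B"
  shows "N\<^sub>R R q \<le> - B"
proof -
  have "0 \<le> A * R\<^sup>2" "0 \<le> 4 * A\<^sub>1 * R\<^sup>2 * (1 + 4 * q\<^sup>2) powr (- (3 / 2))"
    "0 \<le> 48 * B\<^sub>1 * (1 + 4 * q\<^sup>2) powr (- (5 / 2))"
    using A A\<^sub>1 B\<^sub>1 by simp_all
  then show ?thesis using assms(2) unfolding N\<^sub>R_def by linarith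
qed

lemma tendsto_N\<^sub>R:
  assumes "(R \<longlongrightarrow> a) G" "(q \<longlongrightarrow> c) G"
  shows "((\<lambda>t. N\<^sub>R (R t) (q t)) \<longlongrightarrow> N\<^sub>R a c) G"
proof -
  have "1 + 4 * c\<^sup>2 \<noteq> 0" using zero_le_power2[of c] by linarith
  then show ?thesis unfolding N\<^sub>R_def using M by (intro tendsto_intros assms) auto
qed

lemma tendsto_N\<^sub>z:
  assumes "(R \<longlongrightarrow> a) G" "(q \<longlongrightarrow> c) G"
  shows "((\<lambda>t. N\<^sub>z (R t) (q t)) \<longlongrightarrow> N\<^sub>z a c) G"
proof -
  have "1 + 4 * c\<^sup>2 \<noteq> 0" using zero_le_power2[of c] by linarith
  then show ?thesis unfolding N\<^sub>z_def by (intro tendsto_intros assms) auto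
qed

text \<open>
  For small \<open>R\<close> the term \<open>- 3 B / R ^ 4\<close> dominates the centrifugal force, so \<open>P\<close> is eventually
  strictly decreasing. If \<open>P\<close> remained nonnegative then \<open>R\<close> would be nondecreasing and could not
  tend to \<open>0\<close>.
\<close>
lemma collision_momentum_negative:
  fixes R z P Q :: "real \<Rightarrow> real" and T\<^sub>0 :: real and b :: ereal
  assumes orb: "orbit {t. T\<^sub>0 < t \<and> ereal t < b} R z P Q" and T0: "ereal T\<^sub>0 < b"
    and R0: "(R \<longlongrightarrow> 0) (forward_end b)"
  shows "eventually (\<lambda>t. P t < 0) (forward_end b)"
proof -
  note o = orbitD[OF orb]
  have "((\<lambda>t. 2 * C\<^sup>2 * R t / M) \<longlongrightarrow> 2 * C\<^sup>2 * 0 / M) (forward_end b)"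
    using M by (intro tendsto_intros R0) auto
  then have "eventually (\<lambda>t. 2 * C\<^sup>2 * R t / M < 2 * B) (forward_end b)"
    by (rule order_tendstoD(2)) (use B in simp)
  then obtain T where T: "T\<^sub>0 < T" "ereal T < b" "\<And>t. T < t \<Longrightarrow> ereal t < b \<Longrightarrow> 2 * C\<^sup>2 * R t / M < 2 * B"
    unfolding eventually_forward_end[OF T0] by blast
  have in_I: "t \<in> {t. T\<^sub>0 < t \<and> ereal t < b}" if "T < t" "ereal t < b" for t using that T(1) by simp
  have less_b: "ereal t < b" if "t \<le> u" "ereal u < b" for t u
    using that by (meson ereal_less_eq(3) order.strict_trans1)
  have fneg: "force_R (R t) (z t) < 0" if t: "T < t" "ereal t < b" for t
  proof -
    have "N\<^sub>R (R t) (z t / R t) \<le> - B"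
      using o(1)[OF in_I[OF t]] T(3)[OF t] by (intro N\<^sub>R_neg) auto
    then have "N\<^sub>R (R t) (z t / R t) < 0" using B by simp
    then show ?thesis using o(1)[OF in_I[OF t]] by (simp add: force_R_eq divide_neg_pos)
  qed
  have decr: "P u < P t" if "T < t" "t < u" "ereal u < b" for t u
  proof (rule DERIV_neg_imp_decreasing[OF that(2)])
    fix v assume v: "t \<le> v" "v \<le> u"
    have v': "T < v" "ereal v < b" using v that less_b[OF v(2)] by auto
    then show "\<exists>y. DERIV P v :> y \<and> y < 0" using o(4)[OF in_I[OF v']] fneg[OF v'] by blast
  qed
  have "\<exists>t\<^sub>1. T < t\<^sub>1 \<and> ereal t\<^sub>1 < b \<and> P t\<^sub>1 < 0"
  proof (rule ccontr)
    assume "\<not> ?thesis"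
    then have nonneg: "P t \<ge> 0" if "T < t" "ereal t < b" for t using that not_le by blast
    obtain t\<^sub>1 where t1: "T < t\<^sub>1" "ereal t\<^sub>1 < b" using ereal_dense2[OF T(2)] by auto
    have "R t\<^sub>1 \<le> R u" if "t\<^sub>1 \<le> u" "ereal u < b" for u
    proof (rule DERIV_nonneg_imp_nondecreasing[OF that(1)])
      fix v assume v: "t\<^sub>1 \<le> v" "v \<le> u"
      have v': "T < v" "ereal v < b" using v t1 less_b[OF v(2) that(2)] by auto
      then show "\<exists>y. DERIV R v :> y \<and> 0 \<le> y" using o(2)[OF in_I[OF v']] nonneg[OF v'] M by force
    qed
    then have "eventually (\<lambda>t. R t\<^sub>1 \<le> R t) (forward_end b)"
      using ereal_dense2[OF t1(2)] unfolding eventually_forward_end[OF t1(2)] by fastforce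
    moreover have "eventually (\<lambda>t. R t < R t\<^sub>1) (forward_end b)"
      by (rule order_tendstoD(2)[OF R0]) (use o(1)[OF in_I[OF t1]] in simp)
    ultimately have "eventually (\<lambda>_. False) (forward_end b)" by eventually_elim simp
    then show False using forward_end_neq_bot[OF T0] by (simp add: trivial_limit_def)
  qed
  then obtain t\<^sub>1 where t1: "T < t\<^sub>1" "ereal t\<^sub>1 < b" "P t\<^sub>1 < 0" by blast
  have "\<forall>t>t\<^sub>1. ereal t < b \<longrightarrow> P t < 0"
    using decr[OF t1(1)] t1(3) by force
  then show ?thesis
    unfolding eventually_forward_end[OF T0] using t1 T(1) by (intro exI[of _ t\<^sub>1]) auto
qed

text \<open>
  Everything is expressed as a function of \<open>\<rho> = R\<close>. As \<open>\<rho>\<close> tends to \<open>0\<close> the momentum \<open>P\<close> tends to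
  \<open>- \<infinity>\<close>, so l'Hopital's rule gives \<open>Q / P \<rightarrow> N\<^sub>z 0 l / N\<^sub>R 0 l\<close>. A second application, to \<open>z / \<rho>\<close>,
  whose derivative quotient is \<open>(\<mu> / 4) (Q / P)\<close>, then identifies the limit \<open>l\<close>
  itself.
\<close>
lemma collision_limit:
  fixes R z P Q :: "real \<Rightarrow> real" and T\<^sub>0 :: real and b :: ereal
  assumes orb0: "orbit {t. T\<^sub>0 < t \<and> ereal t < b} R z P Q" and T0: "ereal T\<^sub>0 < b"
    and R0: "(R \<longlongrightarrow> 0) (forward_end b)"
    and l: "((\<lambda>t. z t / R t) \<longlongrightarrow> l) (forward_end b)"
  shows "\<mu> / 4 * N\<^sub>z 0 l = l * N\<^sub>R 0 l"
    and "((\<lambda>t. z t / R t - \<mu> / 4 * (Q t / P t)) \<longlongrightarrow> 0) (forward_end b)"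
proof -
  obtain T\<^sub>1 where T1: "T\<^sub>0 < T\<^sub>1" "ereal T\<^sub>1 < b" and neg0: "\<And>t. T\<^sub>1 < t \<Longrightarrow> ereal t < b \<Longrightarrow> P t < 0"
    using collision_momentum_negative[OF orb0 T0 R0] unfolding eventually_forward_end[OF T0] by blast
  define I where "I = {t. T\<^sub>1 < t \<and> ereal t < b}"
  have orb: "orbit I R z P Q" by (rule orbit_subset[OF orb0]) (use T1 in \<open>auto simp: I_def\<close>)
  note o = orbitD[OF orb]
  have neg: "P t < 0" if "t \<in> I" for t using neg0 that by (simp add: I_def)
  have to0: "\<exists>t\<in>I. R t < \<epsilon>" if "\<epsilon> > 0" for \<epsilon>
  proof -
    have "eventually (\<lambda>t. R t < \<epsilon>) (forward_end b)" using order_tendstoD(2)[OF R0 that] .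
    then obtain T where T: "T\<^sub>1 < T" "ereal T < b" "\<forall>t>T. ereal t < b \<longrightarrow> R t < \<epsilon>"
      unfolding eventually_forward_end[OF T1(2)] by blast
    obtain t where "T < t" "ereal t < b" using ereal_dense2[OF T(2)] by auto
    then show ?thesis using T by (intro bexI[of _ t]) (auto simp: I_def)
  qed
  obtain T where T: "T \<in> I" using to0[of 1] by auto
  have R'_neg: "2 * P t / M < 0" if "t \<in> I" for t
    using neg[OF that] M by (simp add: divide_neg_pos)
  obtain \<rho>\<^sub>1 \<tau> where \<rho>1: "R T < \<rho>\<^sub>1" and "\<tau> (R T) = T" and
    \<tau>: "\<And>\<rho>. 0 < \<rho> \<Longrightarrow> \<rho> < \<rho>\<^sub>1 \<Longrightarrow> \<tau> \<rho> \<in> I \<and> R (\<tau> \<rho>) = \<rho> \<and>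
      (\<tau> has_real_derivative inverse (2 * P (\<tau> \<rho>) / M)) (at \<rho>)"
    and decr: "\<And>t u. t \<in> I \<Longrightarrow> u \<in> I \<Longrightarrow> t < u \<Longrightarrow> R u < R t"
    using inverse_of_decreasing_to_0[of T\<^sub>1 b R "\<lambda>t. 2 * P t / M" T, folded I_def, OF o(2) R'_neg to0 T]
    by metis
  have \<rho>1pos: "0 < \<rho>\<^sub>1" using \<rho>1 o(1)[OF T] by simp
  have \<tau>R: "\<tau> (R t) = t" if "t \<in> I" "R t < \<rho>\<^sub>1" for t
  proof -
    have *: "\<tau> (R t) \<in> I" "R (\<tau> (R t)) = R t" using \<tau>[OF o(1)[OF that(1)] that(2)] by auto
    then show ?thesis using decr[OF *(1) that(1)] decr[OF that(1) *(1)] by (metis linorder_neqE_linordered_idom order_less_irrefl)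
  qed
  have near0: "eventually (\<lambda>\<rho>. 0 < \<rho> \<and> \<rho> < r) (at_right 0)" if "0 < r" for r :: real
    using that unfolding eventually_at_right[OF that] by auto
  have lim\<tau>: "filterlim \<tau> (forward_end b) (at_right 0)"
    unfolding filterlim_iff
  proof (intro allI impI)
    fix S assume "eventually S (forward_end b)"
    then obtain u where u: "T\<^sub>1 < u" "ereal u < b" "\<And>t. u < t \<Longrightarrow> ereal t < b \<Longrightarrow> S t"
      unfolding eventually_forward_end[OF T1(2)] by blast
    have uI: "u \<in> I" using u by (simp add: I_def)
    have "eventually (\<lambda>\<rho>. 0 < \<rho> \<and> \<rho> < min \<rho>\<^sub>1 (R u)) (at_right 0)"
      by (rule near0) (use \<rho>1pos o(1)[OF uI] in simp)
    then show "eventually (\<lambda>\<rho>. S (\<tau> \<rho>)) (at_right 0)"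
    proof eventually_elim
      case (elim \<rho>)
      have \<tau>I: "\<tau> \<rho> \<in> I" "R (\<tau> \<rho>) = \<rho>" using \<tau> elim by auto
      then have "\<not> \<tau> \<rho> \<le> u" using decr[OF \<tau>I(1) uI] elim by force
      then show ?case using u(3) \<tau>I(1) by (simp add: I_def)
    qed
  qed
  have evI: "eventually (\<lambda>t. t \<in> I \<and> R t < \<rho>\<^sub>1) (forward_end b)"
  proof (rule eventually_conj)
    show "eventually (\<lambda>t. t \<in> I) (forward_end b)"
      unfolding eventually_forward_end[OF T1(2)]
      using T by (intro exI[of _ T]) (auto simp: I_def)
  qed (rule order_tendstoD(2)[OF R0 \<rho>1pos])
  have limR: "filterlim R (at_right 0) (forward_end b)"
    unfolding filterlim_at using R0 evI by (auto elim!: eventually_mono simp: o(1) less_imp_neq[OF o(1), symmetric])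
  define zz PP QQ where "zz \<rho> = z (\<tau> \<rho>)" and "PP \<rho> = P (\<tau> \<rho>)" and "QQ \<rho> = Q (\<tau> \<rho>)" for \<rho>
  have PPneg: "PP \<rho> < 0" if "0 < \<rho>" "\<rho> < \<rho>\<^sub>1" for \<rho>
    using \<tau>[OF that] neg by (simp add: PP_def)
  have dz: "(zz has_real_derivative \<mu> / 4 * (QQ \<rho> / PP \<rho>)) (at \<rho>)"
    and dP: "(PP has_real_derivative force_R \<rho> (zz \<rho>) * (M / (2 * PP \<rho>))) (at \<rho>)"
    and dQ: "(QQ has_real_derivative force_z \<rho> (zz \<rho>) * (M / (2 * PP \<rho>))) (at \<rho>)"
    if "0 < \<rho>" "\<rho> < \<rho>\<^sub>1" for \<rho>
  proof -
    have t: "\<tau> \<rho> \<in> I" "R (\<tau> \<rho>) = \<rho>" and d\<tau>: "(\<tau> has_real_derivative M / (2 * PP \<rho>)) (at \<rho>)"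
      using \<tau>[OF that] by (auto simp: PP_def)
    note d = o[OF t(1), unfolded t(2)]
    show "(zz has_real_derivative \<mu> / 4 * (QQ \<rho> / PP \<rho>)) (at \<rho>)"
      unfolding zz_def[abs_def]
      by (rule DERIV_cong[OF DERIV_chain2[OF d(3) d\<tau>]])
        (use M PPneg[OF that] in \<open>simp add: QQ_def field_simps\<close>)
    show "(PP has_real_derivative force_R \<rho> (zz \<rho>) * (M / (2 * PP \<rho>))) (at \<rho>)"
      using DERIV_chain2[OF d(4) d\<tau>] by (simp add: PP_def[abs_def] zz_def)
    show "(QQ has_real_derivative force_z \<rho> (zz \<rho>) * (M / (2 * PP \<rho>))) (at \<rho>)"
      using DERIV_chain2[OF d(5) d\<tau>] by (simp add: QQ_def[abs_def] zz_def)
  qed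
  have limq: "((\<lambda>\<rho>. zz \<rho> / \<rho>) \<longlongrightarrow> l) (at_right 0)"
  proof (rule Lim_transform_eventually)
    show "((\<lambda>\<rho>. z (\<tau> \<rho>) / R (\<tau> \<rho>)) \<longlongrightarrow> l) (at_right 0)"
      by (rule filterlim_compose[OF l lim\<tau>])
    show "eventually (\<lambda>\<rho>. z (\<tau> \<rho>) / R (\<tau> \<rho>) = zz \<rho> / \<rho>) (at_right 0)"
      using near0[OF \<rho>1pos] by eventually_elim (use \<tau> in \<open>auto simp: zz_def\<close>)
  qed
  \<comment> \<open>Below \<open>\<rho>\<^sub>2\<close> the centrifugal term is at most \<open>2 B / \<rho> ^ 4\<close>, which leaves a third of the term \<open>- 3 B / \<rho> ^ 4\<close>.\<close>
  define \<rho>\<^sub>2 where "\<rho>\<^sub>2 = min (min \<rho>\<^sub>1 1) (M * B / (C\<^sup>2 + 1))"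
  have \<rho>2: "0 < \<rho>\<^sub>2" "\<rho>\<^sub>2 \<le> \<rho>\<^sub>1" "\<rho>\<^sub>2 \<le> 1" "\<rho>\<^sub>2 \<le> M * B / (C\<^sup>2 + 1)"
    using \<rho>1pos M B by (auto simp: \<rho>\<^sub>2_def intro!: divide_pos_pos add_nonneg_pos)
  have FR: "force_R \<rho> y \<le> - B / \<rho> ^ 4" if "0 < \<rho>" "\<rho> < \<rho>\<^sub>2" for \<rho> y
  proof -
    have "C\<^sup>2 * \<rho> \<le> (C\<^sup>2 + 1) * (M * B / (C\<^sup>2 + 1))"
      using that \<rho>2 by (intro mult_mono) auto
    also have "\<dots> = M * B" by (simp add: add_nonneg_eq_0_iff)
    finally have "2 * C\<^sup>2 * \<rho> / M \<le> 2 * B" using M by (simp add: field_simps)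
    then show ?thesis
      using that(1) by (simp only: force_R_eq) (intro divide_right_mono N\<^sub>R_neg; simp)
  qed
  have FRneg: "force_R \<rho> y < 0" if "0 < \<rho>" "\<rho> < \<rho>\<^sub>2" for \<rho> y
  proof -
    have "- B / \<rho> ^ 4 < 0" using B that by simp
    then show ?thesis using FR[OF that, of y] by linarith
  qed
  have PPtop: "filterlim (\<lambda>\<rho>. - PP \<rho>) at_top (at_right 0)"
  proof -
    \<comment> \<open>As \<open>(PP\<^sup>2)' = M * force_R \<le> - M B / \<rho>\<^sup>4\<close>, already the weaker comparison with \<open>M B / \<rho>\<close> forces divergence.\<close>
    define G where "G \<rho> = (PP \<rho>)\<^sup>2 - M * B / \<rho>" for \<rho>
    define r where "r = \<rho>\<^sub>2 / 2"
    have r: "0 < r" "r < \<rho>\<^sub>2" using \<rho>2(1) by (auto simp: r_def)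
    have G: "G r \<le> G \<rho>" if \<rho>: "0 < \<rho>" "\<rho> < r" for \<rho>
    proof (rule DERIV_nonpos_imp_nonincreasing[of \<rho> r])
      fix x assume x: "\<rho> \<le> x" "x \<le> r"
      have x1: "0 < x" "x < \<rho>\<^sub>1" "x < \<rho>\<^sub>2" "x \<le> 1" using x \<rho> r \<rho>2 by auto
      have dinv: "((\<lambda>x. M * B / x) has_real_derivative - (M * B / x\<^sup>2)) (at x)"
        using x1(1) by (auto intro!: derivative_eq_intros simp: power2_eq_square)
      have "(G has_real_derivative
          2 * PP x * (force_R x (zz x) * (M / (2 * PP x))) + M * B / x\<^sup>2) (at x)"
        unfolding G_def[abs_def]
        by (rule DERIV_cong[OF DERIV_diff[OF DERIV_power[OF dP[OF x1(1,2)], of 2] dinv]]) simp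
      moreover have "2 * PP x * (force_R x (zz x) * (M / (2 * PP x))) = M * force_R x (zz x)"
        using PPneg[OF x1(1,2)] by simp
      moreover have "M * force_R x (zz x) \<le> M * (- B / x ^ 4)"
        using M by (intro mult_left_mono FR x1) auto
      moreover have "M * B / x\<^sup>2 \<le> M * B / x ^ 4"
        using M B x1 power_decreasing[of 2 4 x] by (intro divide_left_mono) auto
      ultimately show "\<exists>y. DERIV G x :> y \<and> y \<le> 0" by (intro exI conjI) (assumption, simp)
    qed (use \<rho> in auto)
    have "filterlim (\<lambda>\<rho>. G r + M * B * inverse \<rho>) at_top (at_right 0)"
      using M B
      by (intro filterlim_tendsto_add_at_top[OF tendsto_const]
          filterlim_tendsto_pos_mult_at_top[OF tendsto_const] filterlim_inverse_at_top_right) auto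
    moreover have "eventually (\<lambda>\<rho>. G r + M * B * inverse \<rho> \<le> (PP \<rho>)\<^sup>2) (at_right 0)"
      using near0[OF r(1)] by eventually_elim (use G in \<open>force simp: G_def divide_inverse\<close>)
    ultimately have "filterlim (\<lambda>\<rho>. (PP \<rho>)\<^sup>2) at_top (at_right 0)"
      by (rule filterlim_at_top_mono)
    then have "filterlim (\<lambda>\<rho>. sqrt ((PP \<rho>)\<^sup>2)) at_top (at_right 0)"
      by (rule filterlim_compose[OF sqrt_at_top])
    moreover have "eventually (\<lambda>\<rho>. sqrt ((PP \<rho>)\<^sup>2) \<le> - PP \<rho>) (at_right 0)"
      using near0[OF \<rho>1pos] by eventually_elim (use PPneg in force)
    ultimately show ?thesis by (rule filterlim_at_top_mono)
  qed
  define p where "p = N\<^sub>z 0 l / N\<^sub>R 0 l"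
  have NR0: "N\<^sub>R 0 l < 0" using N\<^sub>R_neg[of 0 l] B by simp
  have limp: "((\<lambda>\<rho>. QQ \<rho> / PP \<rho>) \<longlongrightarrow> p) (at_right 0)"
  proof -
    have "((\<lambda>\<rho>. QQ \<rho> / - PP \<rho>) \<longlongrightarrow> - p) (at_right 0)"
    proof (rule lhopital_right_at_top[OF PPtop])
      show "eventually (\<lambda>\<rho>. - (force_R \<rho> (zz \<rho>) * (M / (2 * PP \<rho>))) \<noteq> 0) (at_right 0)"
        using near0[OF \<rho>2(1)]
      proof eventually_elim
        case (elim \<rho>)
        then show ?case using FRneg[of \<rho> "zz \<rho>"] PPneg[of \<rho>] \<rho>2 M by auto
      qed
      show "eventually (\<lambda>\<rho>. DERIV QQ \<rho> :> force_z \<rho> (zz \<rho>) * (M / (2 * PP \<rho>))) (at_right 0)"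
        using near0[OF \<rho>1pos] by eventually_elim (use dQ in blast)
      show "eventually (\<lambda>\<rho>. DERIV (\<lambda>\<rho>. - PP \<rho>) \<rho> :> - (force_R \<rho> (zz \<rho>) * (M / (2 * PP \<rho>)))) (at_right 0)"
        using near0[OF \<rho>1pos] by eventually_elim (use dP DERIV_minus in blast)
      have "((\<lambda>\<rho>. - (N\<^sub>z \<rho> (zz \<rho> / \<rho>) / N\<^sub>R \<rho> (zz \<rho> / \<rho>))) \<longlongrightarrow> - p) (at_right 0)"
        unfolding p_def using NR0
        by (intro tendsto_minus tendsto_divide tendsto_N\<^sub>z tendsto_N\<^sub>R limq) auto
      then show "((\<lambda>\<rho>. force_z \<rho> (zz \<rho>) * (M / (2 * PP \<rho>)) / - (force_R \<rho> (zz \<rho>) * (M / (2 * PP \<rho>)))) \<longlongrightarrow> - p) (at_right 0)"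
      proof (rule Lim_transform_eventually)
        show "eventually (\<lambda>\<rho>. - (N\<^sub>z \<rho> (zz \<rho> / \<rho>) / N\<^sub>R \<rho> (zz \<rho> / \<rho>)) =
            force_z \<rho> (zz \<rho>) * (M / (2 * PP \<rho>)) / - (force_R \<rho> (zz \<rho>) * (M / (2 * PP \<rho>)))) (at_right 0)"
          using near0[OF \<rho>2(1)]
        proof eventually_elim
          case (elim \<rho>)
          then show ?case using PPneg[of \<rho>] \<rho>2 M by (simp add: force_z_eq force_R_eq)
        qed
      qed
    qed
    from tendsto_minus[OF this] show ?thesis by simp
  qed
  have "((\<lambda>\<rho>. zz \<rho> / \<rho>) \<longlongrightarrow> \<mu> / 4 * p) (at_right 0)"
  proof (rule lhopital_right_0[where ?g0.0 = "\<lambda>\<rho>. \<rho>" and g' = "\<lambda>_. 1"])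
    have "((\<lambda>\<rho>. zz \<rho> / \<rho> * \<rho>) \<longlongrightarrow> l * 0) (at_right 0)"
      by (intro tendsto_mult limq tendsto_ident_at)
    moreover have "eventually (\<lambda>\<rho>. zz \<rho> / \<rho> * \<rho> = zz \<rho>) (at_right 0)"
      using near0[OF \<rho>1pos] by eventually_elim simp
    ultimately have "(zz \<longlongrightarrow> l * 0) (at_right 0)" by (rule Lim_transform_eventually)
    then show "(zz \<longlongrightarrow> 0) (at_right 0)" by simp
    show "eventually (\<lambda>\<rho>. DERIV zz \<rho> :> \<mu> / 4 * (QQ \<rho> / PP \<rho>)) (at_right 0)"
      using near0[OF \<rho>1pos] by eventually_elim (use dz in blast)
    show "eventually (\<lambda>\<rho>. \<rho> \<noteq> 0) (at_right (0::real))"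
      using near0[OF \<rho>1pos] by eventually_elim simp
    show "((\<lambda>\<rho>. \<mu> / 4 * (QQ \<rho> / PP \<rho>) / 1) \<longlongrightarrow> \<mu> / 4 * p) (at_right 0)"
      using tendsto_mult_left[OF limp, of "\<mu> / 4"] by simp
  qed (auto intro!: tendsto_ident_at derivative_eq_intros)
  then have lp: "l = \<mu> / 4 * p"
    using tendsto_unique[OF _ limq] by simp
  then show "\<mu> / 4 * N\<^sub>z 0 l = l * N\<^sub>R 0 l"
  proof -
    have Nz: "N\<^sub>z 0 l = p * N\<^sub>R 0 l" using NR0 by (simp add: p_def)
    show ?thesis
      using arg_cong[OF lp, of "\<lambda>x. x * N\<^sub>R 0 l"] unfolding Nz by (simp only: mult.assoc)
  qed
  have "((\<lambda>\<rho>. zz \<rho> / \<rho> - \<mu> / 4 * (QQ \<rho> / PP \<rho>)) \<longlongrightarrow> l - \<mu> / 4 * p) (at_right 0)"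
    by (intro tendsto_diff limq tendsto_mult_left limp)
  then have "((\<lambda>\<rho>. zz \<rho> / \<rho> - \<mu> / 4 * (QQ \<rho> / PP \<rho>)) \<longlongrightarrow> 0) (at_right 0)"
    using lp by simp
  from filterlim_compose[OF this limR]
  show "((\<lambda>t. z t / R t - \<mu> / 4 * (Q t / P t)) \<longlongrightarrow> 0) (forward_end b)"
  proof (rule Lim_transform_eventually)
    show "eventually (\<lambda>t. zz (R t) / R t - \<mu> / 4 * (QQ (R t) / PP (R t)) =
        z t / R t - \<mu> / 4 * (Q t / P t)) (forward_end b)"
      using evI by eventually_elim (simp add: zz_def PP_def QQ_def \<tau>R)
  qed
qed

section \<open>Non-degenerate equilibrium shapes are saddles\<close>

lemma shape_field_strictly_differentiable:
  assumes "\<Phi> (fst a) (fst (snd a)) \<noteq> 0"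
  shows "strictly_differentiable shape_field a"
proof -
  have g: "1 + 4 * (fst (snd a))\<^sup>2 > 0" by (simp add: add_pos_nonneg)
  have f: "strictly_differentiable fst a" "strictly_differentiable (\<lambda>x. fst (snd x)) a"
    "strictly_differentiable (\<lambda>x. snd (snd x)) a"
    by (intro strictly_differentiable_bounded_linear bounded_linear_fst bounded_linear_fst_comp
        bounded_linear_snd_comp bounded_linear_snd)+
  show ?thesis
    unfolding shape_field_def case_prod_beta N\<^sub>z_def N\<^sub>R_def \<Phi>_def
    using M assms g \<mu>_gt_1
    by (intro strictly_differentiable_intros f) (auto simp: \<Phi>_def)
qed

text \<open>
  Cancelling \<open>l\<close> in the equilibrium condition leaves the condition on
  the Schwarzschild terms alone, since the others vanish at \<open>R = 0\<close>.
\<close>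
lemma equilibrium_shape:
  assumes "\<mu> / 4 * N\<^sub>z 0 l = l * N\<^sub>R 0 l" "l \<noteq> 0"
  shows "16 * B\<^sub>1 * (\<mu> - 1) * (1 + 4 * l\<^sup>2) powr (- (5 / 2)) = B"
proof -
  define Y where "Y = (1 + 4 * l\<^sup>2) powr (- (5 / 2))"
  have "\<mu> / 4 * (- 16 * l * (12 * B\<^sub>1 * Y)) = l * (- 3 * B - 48 * B\<^sub>1 * Y)"
    using assms(1) by (simp add: N\<^sub>z_def N\<^sub>R_def Y_def)
  then have "l * (48 * \<mu> * B\<^sub>1 * Y) = l * (3 * B + 48 * B\<^sub>1 * Y)" by (simp add: algebra_simps)
  then have "48 * \<mu> * B\<^sub>1 * Y = 3 * B + 48 * B\<^sub>1 * Y" using assms(2) by simp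
  then show ?thesis unfolding Y_def[symmetric] by (simp add: algebra_simps)
qed

lemma finite_equilibrium_shapes: "finite {l. l \<noteq> 0 \<and> \<mu> / 4 * N\<^sub>z 0 l = l * N\<^sub>R 0 l}"
proof -
  define c where "c = ((B / (16 * B\<^sub>1 * (\<mu> - 1))) powr (- (2 / 5)) - 1) / 4"
  have "l \<in> {sqrt c, - sqrt c}" if l: "l \<noteq> 0" "\<mu> / 4 * N\<^sub>z 0 l = l * N\<^sub>R 0 l" for l
  proof -
    have g: "1 + 4 * l\<^sup>2 > 0" by (simp add: add_pos_nonneg)
    have "(1 + 4 * l\<^sup>2) powr (- (5 / 2)) = B / (16 * B\<^sub>1 * (\<mu> - 1))"
      using equilibrium_shape[OF l(2,1)] B\<^sub>1 \<mu>_gt_1 by (simp add: field_simps)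
    then have "((1 + 4 * l\<^sup>2) powr (- (5 / 2))) powr (- (2 / 5))
        = (B / (16 * B\<^sub>1 * (\<mu> - 1))) powr (- (2 / 5))" by simp
    then have "1 + 4 * l\<^sup>2 = (B / (16 * B\<^sub>1 * (\<mu> - 1))) powr (- (2 / 5))"
      using g by (simp add: powr_powr)
    then have "l\<^sup>2 = c" by (simp add: c_def)
    then have "\<bar>l\<bar> = sqrt c" by (metis real_sqrt_abs)
    then show ?thesis by (auto simp: abs_if split: if_splits)
  qed
  then have "{l. l \<noteq> 0 \<and> \<mu> / 4 * N\<^sub>z 0 l = l * N\<^sub>R 0 l} \<subseteq> {sqrt c, - sqrt c}" by blast
  then show ?thesis by (rule finite_subset) simp
qed

lemma \<Phi>_0_pos: "\<Phi> 0 l > 0"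
  unfolding \<Phi>_def using B B\<^sub>1 by (simp add: add_pos_nonneg)

text \<open>
  On the axis \<open>R = w = 0\<close> the field is \<open>K q * X q\<close> with \<open>K > 0\<close> and
  \<open>X q = q (3 B - 48 B\<^sub>1 (\<mu> - 1) (1 + 4 q\<^sup>2) powr (- 5 / 2))\<close>. The bracket vanishes at \<open>l\<close> and increases with
  \<open>q\<^sup>2\<close>, so \<open>X' l > 0\<close> on either side of \<open>0\<close>.
\<close>
lemma equilibrium_is_saddle:
  assumes eq: "\<mu> / 4 * N\<^sub>z 0 l = l * N\<^sub>R 0 l" and l: "l \<noteq> 0"
    and d: "has_strict_derivative shape_field F' (0, l, 0)"
  shows "F' (0, 1, 0) > 0"
proof -
  define Y where "Y q = (1 + 4 * q\<^sup>2) powr (- (5 / 2))" for q :: real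
  define X where "X q = q * (3 * B - 48 * B\<^sub>1 * (\<mu> - 1) * Y q)" for q
  define K where "K q = (1 + 4 / \<mu> * q\<^sup>2) / (2 * \<Phi> 0 q)" for q
  have g: "1 + 4 * l\<^sup>2 > 0" by (simp add: add_pos_nonneg)
  have F: "shape_field (0, q, 0) = K q * X q" for q
  proof -
    have "\<mu> / 4 * N\<^sub>z 0 q - q * N\<^sub>R 0 q = X q"
      by (simp add: N\<^sub>z_def N\<^sub>R_def X_def Y_def[symmetric] algebra_simps)
    then show ?thesis by (simp add: shape_field_def K_def)
  qed
  have "48 * B\<^sub>1 * (\<mu> - 1) * Y l = 3 * B"
    using equilibrium_shape[OF eq l] by (simp add: Y_def)
  then have X0: "X l = 0" by (simp add: X_def)
  define Y' where "Y' = - (5 / 2) * (1 + 4 * l\<^sup>2) powr (- (5 / 2) - 1) * (8 * l)"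
  have dY: "(Y has_real_derivative Y') (at l)"
  proof -
    have "((\<lambda>q. 1 + 4 * q\<^sup>2) has_real_derivative 8 * l) (at l)"
      by (auto intro!: derivative_eq_intros)
    from DERIV_chain2[where f = "\<lambda>y::real. y powr (- (5 / 2))" and g = "\<lambda>q. 1 + 4 * q\<^sup>2" and x = l,
        OF has_real_derivative_powr[OF g] this]
    show ?thesis unfolding Y_def[abs_def] Y'_def by (simp only: mult_ac)
  qed
  have dX: "(X has_real_derivative - 48 * B\<^sub>1 * (\<mu> - 1) * (l * Y')) (at l)"
    unfolding X_def[abs_def]
    by (rule derivative_eq_intros dY refl)+
      (use \<open>48 * B\<^sub>1 * (\<mu> - 1) * Y l = 3 * B\<close> in \<open>simp add: algebra_simps\<close>)
  have dK: "\<exists>K'. (K has_real_derivative K') (at l)"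
  proof -
    have "\<exists>\<Phi>'. (\<Phi> 0 has_real_derivative \<Phi>') (at l)"
      unfolding \<Phi>_def[abs_def] using g
      by (auto intro!: derivative_eq_intros exI DERIV_chain2[OF has_real_derivative_powr])
    then obtain \<Phi>' where "(\<Phi> 0 has_real_derivative \<Phi>') (at l)" by blast
    then show ?thesis unfolding K_def[abs_def] using \<Phi>_0_pos[of l] \<mu>_gt_1
      by (auto intro!: derivative_eq_intros exI)
  qed
  then obtain K' where dK: "(K has_real_derivative K') (at l)" by blast
  have "((\<lambda>q. shape_field (0, q, 0)) has_real_derivative
      K' * X l + (- 48 * B\<^sub>1 * (\<mu> - 1) * (l * Y')) * K l) (at l)"
    unfolding F by (rule DERIV_mult[OF dK dX])
  then have dF: "((\<lambda>q. shape_field (0, q, 0)) has_real_derivative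
      - 48 * B\<^sub>1 * (\<mu> - 1) * (l * Y') * K l) (at l)"
    using X0 by simp
  have "((\<lambda>q. shape_field (0, q, 0)) has_real_derivative F' (0, 1, 0)) (at l)"
  proof -
    have "(shape_field has_derivative F') (at (0, l, 0))"
      by (rule has_strict_derivative_imp_has_derivative[OF d])
    moreover have "((\<lambda>q::real. (0::real, q, 0::real)) has_derivative (\<lambda>v. (0, v, 0))) (at l)"
      by (auto intro!: derivative_eq_intros)
    ultimately have "((\<lambda>q. shape_field (0, q, 0)) has_derivative (\<lambda>v. F' (0, v, 0))) (at l)"
      by (rule has_derivative_compose[rotated])
    moreover have "(\<lambda>v. F' (0, v, 0)) = (*) (F' (0, 1, 0))"
    proof
      fix v
      have "linear F'" using d by (simp add: has_strict_derivative_def bounded_linear.linear)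
      from linear_scale[OF this, of v "(0, 1, 0)"] show "F' (0, v, 0) = F' (0, 1, 0) * v"
        by (simp add: mult.commute)
    qed
    ultimately show ?thesis by (simp only: has_field_derivative_def)
  qed
  then have "F' (0, 1, 0) = - 48 * B\<^sub>1 * (\<mu> - 1) * (l * Y') * K l"
    by (rule DERIV_unique[OF _ dF])
  then have "F' (0, 1, 0) = 48 * B\<^sub>1 * (\<mu> - 1) * (- l * Y') * K l" by simp
  moreover have "48 * B\<^sub>1 * (\<mu> - 1) > 0" using B\<^sub>1 \<mu>_gt_1 by simp
  moreover have "- l * Y' > 0"
  proof -
    have "20 * l\<^sup>2 * (1 + 4 * l\<^sup>2) powr (- (5 / 2) - 1) > 0" using g l by (intro mult_pos_pos) auto
    then show "- l * Y' > 0" by (simp add: Y'_def power2_eq_square)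
  qed
  moreover have "K l > 0"
    using \<Phi>_0_pos[of l] \<mu>_gt_1 by (auto simp: K_def intro!: divide_pos_pos add_pos_nonneg)
  ultimately show ?thesis by (simp only: mult_pos_pos)
qed

section \<open>The collision set is a null set\<close>

lemma vector_field_lipschitz_on_phase_box:
  assumes n: "n > 0"
  obtains L where "L-lipschitz_on (phase_box n) (hamiltonian_vector_field H)"
proof -
  define v where "v = (\<lambda>p::phase. (2 * fst (snd (snd p)) / M, \<mu> * snd (snd (snd p)) / (2 * M),
    force_R (fst p) (fst (snd p)), force_z (fst p) (fst (snd p))))"
  have "strictly_differentiable v a" if "a \<in> phase_box n" for a
  proof -
    have R: "fst a > 0" using that n by (auto simp: phase_box_def intro: less_le_trans[of 0 "1 / real n"])
    then have S: "(fst a)\<^sup>2 + 4 * (fst (snd a))\<^sup>2 > 0" by (simp add: add_pos_nonneg)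
    have f: "strictly_differentiable fst a" "strictly_differentiable (\<lambda>x. fst (snd x)) a"
      "strictly_differentiable (\<lambda>x. fst (snd (snd x))) a" "strictly_differentiable (\<lambda>x. snd (snd (snd x))) a"
      by (intro strictly_differentiable_bounded_linear bounded_linear_fst bounded_linear_fst_comp
          bounded_linear_snd_comp bounded_linear_snd)+
    show ?thesis
      unfolding v_def force_R_def force_z_def using R S M
      by (intro strictly_differentiable_intros f) auto
  qed
  then obtain L where L: "L-lipschitz_on (phase_box n) v"
    using strictly_differentiable_imp_lipschitz_on_compact[OF compact_phase_box] by blast
  have "hamiltonian_vector_field H p = v p" if "p \<in> phase_box n" for p
  proof -
    obtain R z P Q where p_eq: "p = (R, z, P, Q)" by (cases p)
    have "R > 0" using that n by (auto simp: phase_box_def p_eq intro: less_le_trans[of 0 "1 / real n"])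
    then show ?thesis by (simp add: p_eq hamiltonian_vector_field_H v_def)
  qed
  then have "L-lipschitz_on (phase_box n) (hamiltonian_vector_field H)"
    using L lipschitz_on_cong by metis
  then show ?thesis by (rule that)
qed

text \<open>
  Recovers a point of the energy level with negative \<open>P\<^sub>R\<close> from its coordinates \<open>(R, q, w)\<close>; the
  root is the solution of the energy relation for \<open>- P\<^sub>R\<close>.
\<close>
definition phase_of_shape :: "real \<times> real \<times> real \<Rightarrow> phase" where
  "phase_of_shape = (\<lambda>(R, q, w).
     let p = 4 / \<mu> * (q - w); P = - ((M * \<Phi> R q / (R ^ 3 * (1 + \<mu> / 4 * p\<^sup>2))) powr (1 / 2))
     in (R, q * R, P, p * P))"

lemma phase_of_shape:
  assumes "R > 0" "P < 0" "H (R, z, P, Q) = h"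
  shows "phase_of_shape (R, z / R, z / R - \<mu> / 4 * (Q / P)) = (R, z, P, Q)"
proof -
  have \<mu>: "\<mu> > 0" using \<mu>_gt_1 by simp
  define p where "p = Q / P"
  have p: "4 / \<mu> * (z / R - (z / R - \<mu> / 4 * (Q / P))) = p" using \<mu> by (simp add: p_def)
  have Q: "Q = p * P" using assms(2) by (simp add: p_def)
  have pos: "1 + \<mu> / 4 * p\<^sup>2 > 0" using \<mu> by (simp add: add_pos_nonneg)
  have "P\<^sup>2 * (1 + \<mu> / 4 * p\<^sup>2) = M * \<Phi> R (z / R) / R ^ 3"
    using energy_eq[OF assms(1,3)] by (simp add: Q power_mult_distrib algebra_simps)
  then have "M * \<Phi> R (z / R) / (R ^ 3 * (1 + \<mu> / 4 * p\<^sup>2)) = P\<^sup>2"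
    using pos assms(1) by (simp add: nonzero_divide_eq_eq nonzero_eq_divide_eq mult_ac)
  then have "(M * \<Phi> R (z / R) / (R ^ 3 * (1 + \<mu> / 4 * p\<^sup>2))) powr (1 / 2) = - P"
    using assms(2) by (simp add: powr_half_sqrt)
  then show ?thesis
    unfolding phase_of_shape_def prod.case p Let_def using assms(1) by (simp add: Q)
qed

lemma phase_of_shape_strictly_differentiable:
  assumes "fst a > 0" "\<Phi> (fst a) (fst (snd a)) > 0"
  shows "strictly_differentiable phase_of_shape a"
proof -
  have g: "1 + 4 * (fst (snd a))\<^sup>2 > 0" by (simp add: add_pos_nonneg)
  have \<mu>: "\<mu> > 0" using \<mu>_gt_1 by simp
  have k: "1 + \<mu> / 4 * (4 / \<mu> * (fst (snd a) - snd (snd a)))\<^sup>2 > 0"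
    using \<mu> by (intro add_pos_nonneg mult_nonneg_nonneg) auto
  have pos: "M * \<Phi> (fst a) (fst (snd a))
      / (fst a ^ 3 * (1 + \<mu> / 4 * (4 / \<mu> * (fst (snd a) - snd (snd a)))\<^sup>2)) > 0"
    using assms M k by (intro divide_pos_pos mult_pos_pos) auto
  have f: "strictly_differentiable fst a" "strictly_differentiable (\<lambda>x. fst (snd x)) a"
    "strictly_differentiable (\<lambda>x. snd (snd x)) a"
    by (intro strictly_differentiable_bounded_linear bounded_linear_fst bounded_linear_fst_comp
        bounded_linear_snd_comp bounded_linear_snd)+
  have \<Phi>: "strictly_differentiable (\<lambda>x. \<Phi> (fst x) (fst (snd x))) a"
    unfolding \<Phi>_def using M g by (intro strictly_differentiable_intros f) auto
  show ?thesis
    unfolding phase_of_shape_def case_prod_beta Let_def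
    using assms(1) \<mu> k pos by (intro strictly_differentiable_intros f \<Phi>) auto
qed

text \<open>
  The last part of a collision orbit: \<open>R\<close> decreases to \<open>0\<close> while \<open>(R, q, w)\<close>
  stays within \<open>\<epsilon>\<close> of the equilibrium.
\<close>
definition final_approach :: "real \<Rightarrow> real \<Rightarrow> real \<Rightarrow> ereal \<Rightarrow> (real \<Rightarrow> phase) \<Rightarrow> bool" where
  "final_approach l \<epsilon> T\<^sub>0 b x \<longleftrightarrow> (\<exists>R z P Q. (\<forall>t. x t = (R t, z t, P t, Q t)) \<and>
     orbit {t. T\<^sub>0 < t \<and> ereal t < b} R z P Q \<and>
     (\<forall>\<delta>>0. \<exists>t>T\<^sub>0. ereal t < b \<and> R t < \<delta>) \<and>
     (\<forall>t>T\<^sub>0. ereal t < b \<longrightarrow> P t < 0 \<and>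
        (R t, z t / R t, z t / R t - \<mu> / 4 * (Q t / P t)) \<in> ball (0, l, 0) \<epsilon>))"

text \<open>
  The initial points of collision orbits, sorted by the data that determine the Lipschitz constants: the limit shape, the box that contains the orbit up to time \<open>T\<close>, and \<open>T\<close>
  itself, which lies in the final approach.
\<close>
definition piece :: "real \<Rightarrow> real \<Rightarrow> nat \<Rightarrow> real \<Rightarrow> phase set" where
  "piece l \<epsilon> n T = {p. \<exists>b x T\<^sub>0. x 0 = p \<and> 0 < T \<and> T\<^sub>0 < T \<and> ereal T < b \<and>
     (\<forall>t. 0 \<le> t \<longrightarrow> t \<le> T \<longrightarrow>
        x t \<in> phase_box n \<and> (x has_vector_derivative hamiltonian_vector_field H (x t)) (at t)) \<and>
     final_approach l \<epsilon> T\<^sub>0 b x}"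

text \<open>
  For two points of the piece, the distance at time \<open>0\<close> is controlled by the one at time \<open>T\<close>
  (Gronwall in the box), this by the distance of the coordinates \<open>(R, q, w)\<close> (\<open>phase_of_shape\<close> is
  Lipschitz on a compact set), and this by two linear functions of the coordinates (the stable
  cone). So the piece has an expanding map to the plane.
\<close>
lemma piece_null:
  assumes eq: "\<mu> / 4 * N\<^sub>z 0 l = l * N\<^sub>R 0 l" and l: "l \<noteq> 0"
  shows "\<exists>\<epsilon>>0. \<forall>n>0. \<forall>T. hausdorff_outer_measure 3 (piece l \<epsilon> n T) = 0"
proof -
  have "strictly_differentiable shape_field (0, l, 0)"
    using \<Phi>_0_pos[of l] by (intro shape_field_strictly_differentiable) simp
  then obtain F' where F': "has_strict_derivative shape_field F' (0, l, 0)"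
    unfolding strictly_differentiable_def by blast
  obtain \<epsilon>\<^sub>0 \<sigma> K where \<epsilon>0: "\<epsilon>\<^sub>0 > 0" and cone: "\<And>r\<^sub>1 q\<^sub>1 w\<^sub>1 r\<^sub>2 q\<^sub>2 w\<^sub>2.
      (\<And>s. 0 \<le> s \<Longrightarrow> (r\<^sub>1 has_real_derivative - r\<^sub>1 s) (at s) \<and> (q\<^sub>1 has_real_derivative w\<^sub>1 s) (at s) \<and>
        (w\<^sub>1 has_real_derivative shape_field (r\<^sub>1 s, q\<^sub>1 s, w\<^sub>1 s)) (at s) \<and> (r\<^sub>1 s, q\<^sub>1 s, w\<^sub>1 s) \<in> ball (0, l, 0) \<epsilon>\<^sub>0) \<Longrightarrow>
      (\<And>s. 0 \<le> s \<Longrightarrow> (r\<^sub>2 has_real_derivative - r\<^sub>2 s) (at s) \<and> (q\<^sub>2 has_real_derivative w\<^sub>2 s) (at s) \<and>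
        (w\<^sub>2 has_real_derivative shape_field (r\<^sub>2 s, q\<^sub>2 s, w\<^sub>2 s)) (at s) \<and> (r\<^sub>2 s, q\<^sub>2 s, w\<^sub>2 s) \<in> ball (0, l, 0) \<epsilon>\<^sub>0) \<Longrightarrow>
      dist (r\<^sub>1 0, q\<^sub>1 0, w\<^sub>1 0) (r\<^sub>2 0, q\<^sub>2 0, w\<^sub>2 0)
        \<le> K * dist (r\<^sub>1 0, w\<^sub>1 0 - \<sigma> * q\<^sub>1 0) (r\<^sub>2 0, w\<^sub>2 0 - \<sigma> * q\<^sub>2 0)"
    by (rule saddle_orbits_in_stable_cone[OF F' equilibrium_is_saddle[OF eq l F']]) blast
  have "\<exists>\<epsilon>\<^sub>1>0. \<forall>y\<in>cball (0, l, 0 :: real) \<epsilon>\<^sub>1. \<Phi> (fst y) (fst (snd y)) > 0"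
  proof -
    have "1 + 4 * q\<^sup>2 \<noteq> 0" for q :: real using zero_le_power2[of q] by linarith
    then have "continuous_on UNIV (\<lambda>y::real\<times>real\<times>real. \<Phi> (fst y) (fst (snd y)))"
      unfolding \<Phi>_def using M by (intro continuous_intros) auto
    then have "open {y::real\<times>real\<times>real. \<Phi> (fst y) (fst (snd y)) > 0}"
      by (intro open_Collect_less continuous_on_const)
    then show ?thesis
      unfolding open_contains_cball using \<Phi>_0_pos[of l] by fastforce
  qed
  then obtain \<epsilon>\<^sub>1 where \<epsilon>1: "\<epsilon>\<^sub>1 > 0"
    "\<And>y. y \<in> cball (0, l, 0 :: real) \<epsilon>\<^sub>1 \<Longrightarrow> \<Phi> (fst y) (fst (snd y)) > 0" by blast
  define \<epsilon> where "\<epsilon> = min \<epsilon>\<^sub>0 \<epsilon>\<^sub>1"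
  have "hausdorff_outer_measure 3 (piece l \<epsilon> n T) = 0" if n: "n > 0" for n T
  proof -
    obtain L where L: "L-lipschitz_on (phase_box n) (hamiltonian_vector_field H)"
      using vector_field_lipschitz_on_phase_box[OF n] .
    define D where "D = cball (0, l, 0 :: real) \<epsilon>\<^sub>1 \<inter> {y. 1 / real n \<le> fst y}"
    have "compact D" unfolding D_def
      by (intro compact_Int_closed compact_cball closed_Collect_le continuous_intros)
    moreover have "strictly_differentiable phase_of_shape y" if "y \<in> D" for y
      using that \<epsilon>1(2)[of y] n
      by (intro phase_of_shape_strictly_differentiable) (auto simp: D_def intro: less_le_trans[of 0 "1 / real n"])
    ultimately obtain L' where L': "L'-lipschitz_on D phase_of_shape"
      using strictly_differentiable_imp_lipschitz_on_compact by blast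
    have L'0: "L' \<ge> 0" using lipschitz_on_nonneg[OF L'] .
    \<comment> \<open>\<open>x\<close> is the solution up to time \<open>T\<close>; \<open>Y\<close> is its point \<open>(R, q, w)\<close> at time \<open>T\<close>, which starts an orbit near the saddle.\<close>
    define good where "good x Y \<longleftrightarrow> 0 < T \<and>
      (\<forall>t. 0 \<le> t \<longrightarrow> t \<le> T \<longrightarrow> x t \<in> phase_box n \<and>
         (x has_vector_derivative hamiltonian_vector_field H (x t)) (at t)) \<and>
      x T = phase_of_shape Y \<and> Y \<in> D \<and>
      (\<exists>r q w. Y = (r 0, q 0, w 0) \<and>
         (\<forall>s\<ge>0. (r has_real_derivative - r s) (at s) \<and> (q has_real_derivative w s) (at s) \<and>
           (w has_real_derivative shape_field (r s, q s, w s)) (at s) \<and>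
           (r s, q s, w s) \<in> ball (0, l, 0) \<epsilon>\<^sub>0))" for x Y
    have ex: "\<exists>x Y. x 0 = p \<and> good x Y" if "p \<in> piece l \<epsilon> n T" for p
    proof -
      have "\<exists>b x T\<^sub>0. x 0 = p \<and> 0 < T \<and> T\<^sub>0 < T \<and> ereal T < b \<and>
          (\<forall>t. 0 \<le> t \<longrightarrow> t \<le> T \<longrightarrow>
            x t \<in> phase_box n \<and> (x has_vector_derivative hamiltonian_vector_field H (x t)) (at t)) \<and>
          final_approach l \<epsilon> T\<^sub>0 b x"
        using that unfolding piece_def by (rule CollectD)
      then obtain b x T\<^sub>0 where orbit_x: "x 0 = p \<and> 0 < T \<and> T\<^sub>0 < T \<and> ereal T < b \<and>
          (\<forall>t. 0 \<le> t \<longrightarrow> t \<le> T \<longrightarrow>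
            x t \<in> phase_box n \<and> (x has_vector_derivative hamiltonian_vector_field H (x t)) (at t)) \<and>
          final_approach l \<epsilon> T\<^sub>0 b x"
        by (elim exE) (rule that)
      then have *: "x 0 = p" "0 < T" "T\<^sub>0 < T" "ereal T < b"
        "\<And>t. 0 \<le> t \<Longrightarrow> t \<le> T \<Longrightarrow>
          x t \<in> phase_box n \<and> (x has_vector_derivative hamiltonian_vector_field H (x t)) (at t)"
        and approach: "final_approach l \<epsilon> T\<^sub>0 b x"
        by auto
      obtain R z P Q where **: "\<And>t. x t = (R t, z t, P t, Q t)"
        "orbit {t. T\<^sub>0 < t \<and> ereal t < b} R z P Q"
        "\<And>\<delta>. \<delta> > 0 \<Longrightarrow> \<exists>t>T\<^sub>0. ereal t < b \<and> R t < \<delta>"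
        "\<And>t. T\<^sub>0 < t \<Longrightarrow> ereal t < b \<Longrightarrow> P t < 0 \<and>
           (R t, z t / R t, z t / R t - \<mu> / 4 * (Q t / P t)) \<in> ball (0, l, 0) \<epsilon>"
        using approach unfolding final_approach_def by auto
      define w where "w t = z t / R t - \<mu> / 4 * (Q t / P t)" for t
      have TI: "T \<in> {t. T\<^sub>0 < t \<and> ereal t < b}" using * by simp
      obtain \<theta> where \<theta>: "\<theta> 0 = T" "\<And>s. 0 \<le> s \<Longrightarrow> \<theta> s \<in> {t. T\<^sub>0 < t \<and> ereal t < b}"
        "\<And>s. 0 \<le> s \<Longrightarrow> ((\<lambda>s. R (\<theta> s)) has_real_derivative - R (\<theta> s)) (at s)"
        "\<And>s. 0 \<le> s \<Longrightarrow> ((\<lambda>s. z (\<theta> s) / R (\<theta> s)) has_real_derivative w (\<theta> s)) (at s)"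
        "\<And>s. 0 \<le> s \<Longrightarrow> ((\<lambda>s. w (\<theta> s)) has_real_derivative
           shape_field (R (\<theta> s), z (\<theta> s) / R (\<theta> s), w (\<theta> s))) (at s)"
        using orbit_as_graph_over_size[OF **(2) _ _ TI, folded w_def] **(3,4) by (auto simp: Bex_def)
      define Y where "Y = (R T, z T / R T, w T)"
      have RP: "R T > 0" "P T < 0" "H (R T, z T, P T, Q T) = h"
        using orbitD[OF **(2) TI] **(4)[of T] TI by auto
      have "Y \<in> ball (0, l, 0) \<epsilon>" unfolding Y_def w_def using **(4)[of T] TI by simp
      moreover have "1 / real n \<le> R T" using *(5)[of T] *(2) **(1)[of T] by (auto simp: phase_box_def)
      ultimately have "Y \<in> D" by (auto simp: D_def Y_def \<epsilon>_def)
      moreover have "x T = phase_of_shape Y"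
        using phase_of_shape[OF RP] **(1)[of T] by (simp add: Y_def w_def)
      moreover have "(R (\<theta> s), z (\<theta> s) / R (\<theta> s), w (\<theta> s)) \<in> ball (0, l, 0) \<epsilon>\<^sub>0" if "0 \<le> s" for s
        using **(4)[of "\<theta> s"] \<theta>(2)[OF that] unfolding w_def \<epsilon>_def by auto
      ultimately have "good x Y"
        unfolding good_def using *(2,5) \<theta>
        by (intro conjI exI[of _ "\<lambda>s. R (\<theta> s)"] exI[of _ "\<lambda>s. z (\<theta> s) / R (\<theta> s)"] exI[of _ "\<lambda>s. w (\<theta> s)"])
          (auto simp: Y_def)
      then show ?thesis using *(1) by blast
    qed
    then obtain x Y where xY: "\<And>p. p \<in> piece l \<epsilon> n T \<Longrightarrow> x p 0 = p \<and> good (x p) (Y p)"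
      by metis
    define f where "f p = (fst (Y p), snd (snd (Y p)) - \<sigma> * fst (snd (Y p)))" for p
    show ?thesis
    proof (rule hausdorff_null_of_expanding_map_to_plane[where f = f and K = "exp (L * T) * (L' * K)"])
      fix p p' assume p: "p \<in> piece l \<epsilon> n T" "p' \<in> piece l \<epsilon> n T"
      note g = xY[OF p(1)] xY[OF p(2)]
      have "dist (x p 0) (x p' 0) \<le> exp (L * T) * dist (x p T) (x p' T)"
        using g unfolding good_def by (intro backward_gronwall[OF L]) auto
      also have "dist (x p T) (x p' T) \<le> L' * dist (Y p) (Y p')"
        using g unfolding good_def by (auto intro: lipschitz_onD[OF L'])
      also have "dist (Y p) (Y p') \<le> K * dist (f p) (f p')"
      proof -
        obtain r\<^sub>1 q\<^sub>1 w\<^sub>1 where 1: "Y p = (r\<^sub>1 0, q\<^sub>1 0, w\<^sub>1 0)"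
         "\<And>s. s \<ge> 0 \<Longrightarrow> (r\<^sub>1 has_real_derivative - r\<^sub>1 s) (at s) \<and> (q\<^sub>1 has_real_derivative w\<^sub>1 s) (at s) \<and>
           (w\<^sub>1 has_real_derivative shape_field (r\<^sub>1 s, q\<^sub>1 s, w\<^sub>1 s)) (at s) \<and>
           (r\<^sub>1 s, q\<^sub>1 s, w\<^sub>1 s) \<in> ball (0, l, 0) \<epsilon>\<^sub>0" using g(1) unfolding good_def by blast
        obtain r\<^sub>2 q\<^sub>2 w\<^sub>2 where 2: "Y p' = (r\<^sub>2 0, q\<^sub>2 0, w\<^sub>2 0)"
         "\<And>s. s \<ge> 0 \<Longrightarrow> (r\<^sub>2 has_real_derivative - r\<^sub>2 s) (at s) \<and> (q\<^sub>2 has_real_derivative w\<^sub>2 s) (at s) \<and>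
           (w\<^sub>2 has_real_derivative shape_field (r\<^sub>2 s, q\<^sub>2 s, w\<^sub>2 s)) (at s) \<and>
           (r\<^sub>2 s, q\<^sub>2 s, w\<^sub>2 s) \<in> ball (0, l, 0) \<epsilon>\<^sub>0" using g(2) unfolding good_def by blast
        show ?thesis using cone[OF 1(2) 2(2)] unfolding f_def 1(1) 2(1) by simp
      qed
      finally show "dist p p' \<le> exp (L * T) * (L' * K) * dist (f p) (f p')"
        using g L'0 by (simp add: mult_left_mono mult.assoc)
    qed simp
  qed
  moreover have "\<epsilon> > 0" using \<epsilon>0 \<epsilon>1 by (simp add: \<epsilon>_def)
  ultimately show ?thesis by blast
qed

text \<open>
  A rational \<open>T\<close> is chosen after the start of the final approach, so that countably many pieces
  suffice.
\<close>
lemma triangular_collision_in_piece: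
  assumes p: "p \<in> triangular_collision_set H h"
  obtains l where "l \<noteq> 0" "\<mu> / 4 * N\<^sub>z 0 l = l * N\<^sub>R 0 l"
    "\<And>\<epsilon>. \<epsilon> > 0 \<Longrightarrow> \<exists>n>0. \<exists>T\<in>\<rat>. p \<in> piece l \<epsilon> n T"
proof -
  obtain a b x l' where *: "p \<in> energy_level H h" "a < 0" "0 < b" "is_solution H a b x" "x 0 = p"
    "leads_to_triple_collision b x" "has_limiting_configuration b x l'" "nondegenerate_triangle l'"
    using p unfolding triangular_collision_set_def is_maximal_solution_def by blast
  obtain l where l: "l' = ereal l" "l \<noteq> 0"
    using *(8) by (cases l') (auto simp: nondegenerate_triangle_def)
  define R z P Q where "R t = fst (x t)" and "z t = fst (snd (x t))"
    and "P t = fst (snd (snd (x t)))" and "Q t = snd (snd (snd (x t)))" for t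
  have x_eq: "x t = (R t, z t, P t, Q t)" for t by (simp add: R_def z_def P_def Q_def)
  have b0: "ereal 0 < b" using *(3) by (simp add: zero_ereal_def)
  have "H (x 0) = h" using *(1,5) by (simp add: energy_level_def)
  from orbit_of_solution[OF *(4,2,3) this] have orb: "orbit (einterval a b) R z P Q"
    by (simp add: R_def[abs_def] z_def[abs_def] P_def[abs_def] Q_def[abs_def])
  have sub: "{t. 0 < t \<and> ereal t < b} \<subseteq> einterval a b"
  proof
    fix t assume t: "t \<in> {t. 0 < t \<and> ereal t < b}"
    have "a < ereal t" by (rule order.strict_trans[OF *(2)]) (use t in \<open>simp add: zero_ereal_def\<close>)
    then show "t \<in> einterval a b" using t by (simp add: einterval_iff)
  qed
  have "((\<lambda>t. (R t, z t)) \<longlongrightarrow> (0, 0)) (forward_end b)"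
    using *(6) unfolding leads_to_triple_collision_def x_eq prod.case forward_end_def
    by (simp add: filterlim_filtermap comp_def)
  from tendsto_fst[OF this] have R0: "(R \<longlongrightarrow> 0) (forward_end b)" by simp
  have "((\<lambda>t. ereal (z t / R t)) \<longlongrightarrow> ereal l) (forward_end b)"
    using *(7) unfolding has_limiting_configuration_def x_eq prod.case forward_end_def l(1)
    by (simp add: filterlim_filtermap comp_def)
  then have q: "((\<lambda>t. z t / R t) \<longlongrightarrow> l) (forward_end b)" by simp
  note orb0 = orbit_subset[OF orb sub]
  note lim = collision_limit[OF orb0 b0 R0 q]
  show ?thesis
  proof (rule that[OF l(2) lim(1)])
    fix \<epsilon> :: real assume \<epsilon>: "\<epsilon> > 0"
    have "((\<lambda>t. (R t, z t / R t, z t / R t - \<mu> / 4 * (Q t / P t))) \<longlongrightarrow> (0, l, 0)) (forward_end b)"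
      by (intro tendsto_Pair R0 q lim(2))
    from tendstoD[OF this \<epsilon>]
    have "eventually (\<lambda>t. (R t, z t / R t, z t / R t - \<mu> / 4 * (Q t / P t)) \<in> ball (0, l, 0) \<epsilon>) (forward_end b)"
      by (simp add: dist_commute)
    from eventually_conj[OF collision_momentum_negative[OF orb0 b0 R0] this]
    obtain T\<^sub>0 where T0: "0 < T\<^sub>0" "ereal T\<^sub>0 < b" "\<And>t. T\<^sub>0 < t \<Longrightarrow> ereal t < b \<Longrightarrow> P t < 0 \<and>
        (R t, z t / R t, z t / R t - \<mu> / 4 * (Q t / P t)) \<in> ball (0, l, 0) \<epsilon>"
      unfolding eventually_forward_end[OF b0] by blast
    obtain u where u: "T\<^sub>0 < u" "ereal u < b" using ereal_dense2[OF T0(2)] by auto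
    obtain T where T: "T \<in> \<rat>" "T\<^sub>0 < T" "T < u" using Rats_dense_in_real[OF u(1)] by blast
    have Tb: "ereal T < b" using T(3) u(2) by (meson less_ereal.simps(1) order.strict_trans)
    have in_ab: "t \<in> einterval a b" if "0 \<le> t" "t \<le> T" for t
    proof -
      have "a < ereal t" using *(2) that(1) by (metis ereal_less_eq(3) order.strict_trans2 zero_ereal_def)
      moreover have "ereal t < b" using Tb that(2) by (meson ereal_less_eq(3) order.strict_trans1)
      ultimately show ?thesis by (simp add: einterval_iff)
    qed
    have sol: "x t \<in> phase_space \<and> (x has_vector_derivative hamiltonian_vector_field H (x t)) (at t)"
      if "0 \<le> t" "t \<le> T" for t
      using *(4) in_ab[OF that] unfolding is_solution_def by blast
    have "continuous_on {0..T} x"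
    proof (intro continuous_at_imp_continuous_on ballI)
      fix t assume "t \<in> {0..T}"
      then show "isCont x t" using has_vector_derivative_continuous[OF conjunct2[OF sol[of t]]] by simp
    qed
    then have "compact (x ` {0..T})" by (rule compact_continuous_image) simp
    moreover have "x ` {0..T} \<subseteq> phase_space" using sol by auto
    ultimately obtain n where n: "n > 0" "x ` {0..T} \<subseteq> phase_box n" by (rule compact_subset_phase_box)
    have sub2: "{t. T\<^sub>0 < t \<and> ereal t < b} \<subseteq> {t. 0 < t \<and> ereal t < b}" using T0(1) by auto
    have to0: "\<exists>t>T\<^sub>0. ereal t < b \<and> R t < \<delta>" if "\<delta> > 0" for \<delta>
    proof -
      have "eventually (\<lambda>t. R t < \<delta>) (forward_end b)" by (rule order_tendstoD(2)[OF R0 that])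
      then obtain T' where T': "T\<^sub>0 < T'" "ereal T' < b" "\<forall>t>T'. ereal t < b \<longrightarrow> R t < \<delta>"
        unfolding eventually_forward_end[OF T0(2)] by blast
      obtain t where "T' < t" "ereal t < b" using ereal_dense2[OF T'(2)] by auto
      then show ?thesis using T' by (intro exI[of _ t]) auto
    qed
    have "p \<in> piece l \<epsilon> n T"
      unfolding piece_def mem_Collect_eq
    proof (intro exI conjI)
      show "x 0 = p" by (rule *(5))
      show "0 < T" using T0(1) T(2) by simp
      show "T\<^sub>0 < T" "ereal T < b" using T Tb by auto
      show "\<forall>t. 0 \<le> t \<longrightarrow> t \<le> T \<longrightarrow>
        x t \<in> phase_box n \<and> (x has_vector_derivative hamiltonian_vector_field H (x t)) (at t)"
        using sol n(2) by auto
      show "final_approach l \<epsilon> T\<^sub>0 b x"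
        unfolding final_approach_def
      proof (intro exI conjI)
        show "\<forall>t. x t = (R t, z t, P t, Q t)" using x_eq by blast
        show "orbit {t. T\<^sub>0 < t \<and> ereal t < b} R z P Q" by (rule orbit_subset[OF orb0 sub2])
        show "\<forall>\<delta>>0. \<exists>t>T\<^sub>0. ereal t < b \<and> R t < \<delta>" using to0 by blast
        show "\<forall>t>T\<^sub>0. ereal t < b \<longrightarrow> P t < 0 \<and>
             (R t, z t / R t, z t / R t - \<mu> / 4 * (Q t / P t)) \<in> ball (0, l, 0) \<epsilon>" using T0(3) by blast
      qed
    qed
    then show "\<exists>n>0. \<exists>T\<in>\<rat>. p \<in> piece l \<epsilon> n T" using n(1) T(1) by blast
  qed
qed

lemma triangular_collision_null:
  "hausdorff_outer_measure 3 (triangular_collision_set H h) = 0"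
proof -
  define E where "E = {l. l \<noteq> 0 \<and> \<mu> / 4 * N\<^sub>z 0 l = l * N\<^sub>R 0 l}"
  have "\<forall>l\<in>E. \<exists>\<epsilon>>0. \<forall>n>0. \<forall>T. hausdorff_outer_measure 3 (piece l \<epsilon> n T) = 0"
    using piece_null by (auto simp: E_def)
  then obtain \<epsilon> where \<epsilon>: "\<And>l. l \<in> E \<Longrightarrow> \<epsilon> l > 0"
    "\<And>l n T. l \<in> E \<Longrightarrow> n > 0 \<Longrightarrow> hausdorff_outer_measure 3 (piece l (\<epsilon> l) n T) = 0"
    by metis
  define V where "V = (\<lambda>(l, n, T). piece l (\<epsilon> l) n T)"
  have "hausdorff_outer_measure 3 (\<Union>i\<in>E \<times> {0<..} \<times> \<rat>. V i) = 0"
  proof (rule hausdorff_null_UN_countable)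
    show "countable (E \<times> {0::nat<..} \<times> (\<rat> :: real set))"
      using finite_equilibrium_shapes by (intro countable_SIGMA countable_rat) (auto simp: E_def countable_finite)
  qed (use \<epsilon> in \<open>auto simp: V_def\<close>)
  moreover have "triangular_collision_set H h \<subseteq> (\<Union>i\<in>E \<times> {0<..} \<times> \<rat>. V i)"
  proof
    fix p assume "p \<in> triangular_collision_set H h"
    then obtain l where l: "l \<in> E" "\<And>\<epsilon>. \<epsilon> > 0 \<Longrightarrow> \<exists>n>0. \<exists>T\<in>\<rat>. p \<in> piece l \<epsilon> n T"
      using triangular_collision_in_piece by (metis (mono_tags, lifting) E_def mem_Collect_eq)
    then obtain n T where "n > 0" "T \<in> \<rat>" "p \<in> piece l (\<epsilon> l) n T" using \<epsilon>(1) by blast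
    then show "p \<in> (\<Union>i\<in>E \<times> {0<..} \<times> \<rat>. V i)"
      using l(1) by (intro UN_I[of "(l, n, T)"]) (auto simp: V_def)
  qed
  ultimately show ?thesis by (rule hausdorff_null_subset)
qed

end

theorem proposition6:
  fixes M m A A\<^sub>1 B B\<^sub>1 C h \<mu> :: real
  assumes "M > 0" and "m > 0" and "A > 0" and "A\<^sub>1 > 0" and "B > 0" and "B\<^sub>1 > 0"
    and "\<mu> = (2 * M + m) / m"
    and "\<mu> > 1 + A / (4 * A\<^sub>1)"
    and "\<mu> > 1 + B / (16 * B\<^sub>1)"
    and "(\<mu> - 1) powr (4 / 15) * (4 * A\<^sub>1 / A) powr (2 / 3) \<noteq> (16 * B\<^sub>1 / B) powr (2 / 5)"
  shows "hausdorff_outer_measure 3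
           (triangular_collision_set (H_red M m A A\<^sub>1 B B\<^sub>1 C) h) = 0"
proof -
  interpret isosceles_schwarzschild M m A A\<^sub>1 B B\<^sub>1 C h \<mu>
    using assms by unfold_locales auto
  show ?thesis by (rule triangular_collision_null)
qed

end
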